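(* Let $\mathbb{P}_n$ be the empirical measure of $n$ i.i.d. observations from a probability measure $P$. For $m>1$ write $m\wedge 2=1+\kappa$ with $\kappa\in(0,1]$. Suppose the class $\mathcal{F}$ of measurable real functions satisfies: (1) for some $\sigma>0$, $\sigma\ge\sup_{f\in\mathcal{F}}\|f\|_{L^{1+\kappa}(P)}$; (2) there is a weight function $w>0$ such that $1/w\in L^m(P)$; (3) $\mathcal{F}$ has an envelope function $F$ with $\|F\|_{L^\infty(w)}<\infty$. Then $$\begin{aligned} \mathbb{E}^\ast\|\mathbb{P}_n-P\|_{\mathcal{F}} \le\ &\frac{127.63}{\kappa}\,\frac{\|1/w\|_{L^{1+\kappa}(P)}^{\frac{1-\kappa}{2}}}{n^{\frac{\kappa}{1+\kappa}}}\Bigl(\int_0^{2\sigma}1+\bigl(\log N(x,\mathcal{F},L^{1+\kappa}(P))\bigr)^{\frac{\kappa}{1+\kappa}}\,dx\Bigr)^{\frac{1+\kappa}{2}}\\ &\qquad\cdot\Bigl(\int_0^{2\|F\|_{L^\infty(w)}}1+\bigl(\log N(x,\mathcal{F},L^{\infty}(w))\bigr)^{\frac{\kappa}{1+\kappa}}\,dx\Bigr)^{\frac{1-\kappa}{2}}\\ &+\frac{104.37}{\kappa}\,\frac{\|1/w\|_{L^m(P)}}{n^{1-\frac1m}}\Bigl(\int_0^{2\|F\|_{L^\infty(w)}}1+\bigl(\log N(x,\mathcal{F},L^{\infty}(w))\bigr)^{1-\frac1m}\,dx\Bigr). \end{aligned}$$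
   Context: $a\wedge b$ denotes the minimum. An envelope function of $\mathcal{F}$ is a function $F\ge 0$ with $|f(x)|\le F(x)$ for all $x$ and all $f\in\mathcal{F}$. $\|f\|_{L^{p}(P)}=(\int|f|^p\,dP)^{1/p}$; the weighted uniform norm is $\|f\|_{L^\infty(w)}=\sup_x |f(x)|\,w(x)$. $\|\mathbb{P}_n-P\|_{\mathcal{F}}=\sup_{f\in\mathcal{F}}|(\mathbb{P}_n-P)f|$ with $Qf=\int f\,dQ$, and $\mathbb{E}^\ast$ is outer expectation. For a (pseudo)metric $d$, a set $K$ and $h>0$, an $h$-covering of $K$ is a subset $C\subseteq K$ such that every point of $K$ is within $d$-distance at most $h$ of some point of $C$; the covering number $N(h,K,d)$ is the smallest cardinality of an $h$-covering. A norm written in place of $d$ means the induced metric. *)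

theory Defs
  imports "HOL-Probability.Probability"
begin

text \<open>
  Norms, distances and integrals of nonnegative quantities take values in \<^typ>\<open>ennreal\<close>, so that
  infinite norms, covering numbers and entropy integrals are literally infinite (the Bochner
  integral would return 0 instead).
\<close>

text \<open>Only used for exponents \<open>p \<ge> 0\<close>; \<open>x\<^sup>0 = 1\<close> also for \<open>x = 0\<close> and \<open>x = \<infinity>\<close>.\<close>

definition epowr :: "ennreal \<Rightarrow> real \<Rightarrow> ennreal" where
  "epowr x p = (if p = 0 then 1 else if x = \<infinity> then \<infinity> else ennreal (enn2real x powr p))"

definition Lp_norm :: "'a measure \<Rightarrow> real \<Rightarrow> ('a \<Rightarrow> real) \<Rightarrow> ennreal" where
  "Lp_norm P p f = epowr (\<integral>\<^sup>+ x. ennreal (\<bar>f x\<bar> powr p) \<partial>P) (1 / p)"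

definition in_Lp :: "'a measure \<Rightarrow> real \<Rightarrow> ('a \<Rightarrow> real) \<Rightarrow> bool" where
  "in_Lp P p f \<longleftrightarrow> f \<in> borel_measurable P \<and> Lp_norm P p f < \<infinity>"

definition weighted_sup_norm :: "'a set \<Rightarrow> ('a \<Rightarrow> real) \<Rightarrow> ('a \<Rightarrow> real) \<Rightarrow> ennreal" where
  "weighted_sup_norm S w f = (SUP x\<in>S. ennreal (\<bar>f x\<bar> * w x))"

definition is_envelope :: "'a set \<Rightarrow> ('a \<Rightarrow> real) set \<Rightarrow> ('a \<Rightarrow> real) \<Rightarrow> bool" where
  "is_envelope S \<F> F \<longleftrightarrow> (\<forall>x\<in>S. 0 \<le> F x \<and> (\<forall>f\<in>\<F>. \<bar>f x\<bar> \<le> F x))"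

definition norm_dist :: "(('a \<Rightarrow> real) \<Rightarrow> ennreal) \<Rightarrow> ('a \<Rightarrow> real) \<Rightarrow> ('a \<Rightarrow> real) \<Rightarrow> ennreal" where
  "norm_dist N f g = N (\<lambda>x. f x - g x)"

definition is_covering :: "real \<Rightarrow> 'b set \<Rightarrow> ('b \<Rightarrow> 'b \<Rightarrow> ennreal) \<Rightarrow> 'b set \<Rightarrow> bool" where
  "is_covering h K d C \<longleftrightarrow> C \<subseteq> K \<and> (\<forall>x\<in>K. \<exists>c\<in>C. d x c \<le> ennreal h)"

text \<open>Equal to \<open>\<infinity>\<close> when there is no finite covering.\<close>

definition covering_number :: "real \<Rightarrow> 'b set \<Rightarrow> ('b \<Rightarrow> 'b \<Rightarrow> ennreal) \<Rightarrow> enat" where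
  "covering_number h K d = (INF C\<in>{C. finite C \<and> is_covering h K d C}. enat (card C))"

text \<open>
  For natural numbers \<open>\<ge> 1\<close>. A covering number is 0 only for the empty class, where the value
  \<open>ln 0 = 0\<close> is harmless.
\<close>

definition ln_enat :: "enat \<Rightarrow> ennreal" where
  "ln_enat N = (case N of enat k \<Rightarrow> ennreal (ln (real k)) | \<infinity> \<Rightarrow> \<infinity>)"

definition entropy_integral ::
  "'b set \<Rightarrow> ('b \<Rightarrow> 'b \<Rightarrow> ennreal) \<Rightarrow> real \<Rightarrow> ennreal \<Rightarrow> ennreal" where
  "entropy_integral K d p b =
     (\<integral>\<^sup>+ x\<in>{x. 0 < x \<and> ennreal x \<le> b}. (1 + epowr (ln_enat (covering_number x K d)) p) \<partial>lborel)"

definition empirical_measure :: "'a measure \<Rightarrow> nat \<Rightarrow> (nat \<Rightarrow> 'a) \<Rightarrow> 'a measure" where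
  "empirical_measure P n x = distr (uniform_count_measure {..<n}) P x"

lemma integral_empirical_measure:
  fixes f :: "'a \<Rightarrow> real"
  assumes "\<And>i. i < n \<Longrightarrow> x i \<in> space P" and "f \<in> borel_measurable P"
  shows "(\<integral>y. f y \<partial>empirical_measure P n x) = (\<Sum>i<n. f (x i)) / real n"
proof -
  have "x \<in> measurable (uniform_count_measure {..<n}) P"
    using assms(1)
    by (auto simp: measurable_def space_uniform_count_measure sets_uniform_count_measure)
  then show ?thesis
    unfolding empirical_measure_def using assms(2)
    by (simp add: integral_distr integral_uniform_count_measure)
qed

definition sup_deviation :: "'a measure \<Rightarrow> 'a measure \<Rightarrow> ('a \<Rightarrow> real) set \<Rightarrow> ennreal" where
  "sup_deviation Q P \<F> = (SUP f\<in>\<F>. ennreal \<bar>(\<integral>x. f x \<partial>Q) - (\<integral>x. f x \<partial>P)\<bar>)"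

text \<open>
  For \<open>Z \<ge> 0\<close> every measurable majorant has a (possibly infinite) expectation, so the infimum
  ranges over all of them.  \<^const>\<open>nn_integral\<close> of \<open>Z\<close> itself would be an inner expectation.
\<close>

definition outer_expectation :: "'o measure \<Rightarrow> ('o \<Rightarrow> ennreal) \<Rightarrow> ennreal" where
  "outer_expectation M Z =
     (INF U\<in>{U \<in> borel_measurable M. \<forall>\<omega>\<in>space M. Z \<omega> \<le> U \<omega>}. \<integral>\<^sup>+ \<omega>. U \<omega> \<partial>M)"

definition iid_sample :: "'o measure \<Rightarrow> 'a measure \<Rightarrow> nat \<Rightarrow> (nat \<Rightarrow> 'o \<Rightarrow> 'a) \<Rightarrow> bool" where
  "iid_sample M P n X \<longleftrightarrow>
     prob_space.indep_vars M (\<lambda>_. P) X {..<n} \<and> (\<forall>i<n. distr M P (X i) = P)"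

end

theory Submission
  imports Defs
begin

text \<open>
The bound is a chaining argument whose building block is a maximal inequality for finite classes with
an unbounded envelope. Write \<open>G = 1/w\<close> and \<open>g\<close> for its \<open>L\<^sup>m\<close> norm. If finitely many functions satisfy
\<open>\<bar>h\<bar> \<le> \<beta> G\<close> and the logarithm of twice their number is at most \<open>n \<Lambda>\<close>, truncate at the level
\<open>G \<le> g \<Lambda> powr (-1/m)\<close>. A Bernstein type exponential moment bound handles the truncated functions, and the
moment of \<open>G\<close> handles the rest; at this level both envelope contributions have the same order
\<open>\<beta> g \<Lambda> powr (1 - 1/m)\<close>. The result is
\<open>2 V sqrt \<Lambda> + 3 \<beta> g \<Lambda> powr (1 - 1/m)\<close>, where \<open>V\<^sup>2\<close> bounds the truncated second moments
(\<open>expected_max_deviation_moment_le\<close>).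

To chain, choose at level \<open>k\<close> finite coverings for the two distances whose cardinalities have
logarithm at most \<open>2 \<cdot> 4\<^sup>k\<close>, with radii close to the smallest possible. Fixing the cardinalities rather than
the radii lets both distances be used simultaneously: one representative per pair of cells
approximates in both distances, and the number of pairs still has logarithm of order \<open>4\<^sup>k\<close>. The
weighted sum of the radii is a lower Riemann sum of the entropy integral (\<open>entropy_radii\<close>), so
summing the maximal inequality over the links gives the entropy integrals up to an explicit
constant. The chain starts at the zero function, and all members of the class have \<open>L\<^sup>1\<^sup>+\<^sup>\<kappa>\<close> norm at
most \<open>\<sigma>\<close> and weighted norm at most that of \<open>F\<close>; the constant 1 in the integrals pays for the first link.

Two regimes remain. If \<open>m \<ge> 2\<close>, then \<open>\<kappa> = 1\<close>; the \<open>L\<^sup>2\<close> distance controls \<open>V\<close> and yields the first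
summand, the weighted sup distance yields the second. If \<open>m < 2\<close>, then \<open>m = 1 + \<kappa>\<close>, and
\<open>h\<^sup>2 \<le> \<beta>\<^sup>2 t powr (2 - m) G powr m\<close> on \<open>G \<le> t\<close> bounds the truncated second moment so well that \<open>V sqrt \<Lambda>\<close> also has
order \<open>\<beta> g \<Lambda> powr (1 - 1/m)\<close>; chaining in the weighted sup distance then bounds the left-hand
side by the second summand. There the geometric series of ratio \<open>4\<close> to the power
\<open>- \<kappa> / (1 + \<kappa>)\<close> produces the factor \<open>1 / \<kappa>\<close>.
\<close>

section \<open>Expected maximum over a finite class by truncation\<close>

lemma exp_le_quadratic:
  fixes x :: real
  assumes "\<bar>x\<bar> \<le> 1"
  shows "exp x \<le> 1 + x + x\<^sup>2"
proof (cases "x \<ge> 0")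
  case True
  then show ?thesis using assms by (intro exp_bound) auto
next
  case False
  define y where "y = - x"
  have y: "0 \<le> y" "y \<le> 1" using False assms by (auto simp: y_def)
  have "1 + y + y\<^sup>2 / 2 \<le> exp y" using y by (intro exp_lower_Taylor_quadratic)
  moreover have "1 \<le> (1 - y + y\<^sup>2) * (1 + y + y\<^sup>2 / 2)"
  proof -
    have "(1 - y + y\<^sup>2) * (1 + y + y\<^sup>2 / 2) = 1 + y^2/2 + y^3/2 + y^4/2"
      by (simp add: field_simps power2_eq_square power3_eq_cube power4_eq_xxxx)
    then show ?thesis using y by simp
  qed
  moreover have "0 \<le> 1 - y + y\<^sup>2" using y by simp
  ultimately have "1 \<le> (1 - y + y\<^sup>2) * exp y"
    by (meson mult_left_mono order_trans)
  then have "exp (- y) \<le> 1 - y + y\<^sup>2"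
    by (simp add: exp_minus field_simps)
  then show ?thesis by (simp add: y_def)
qed

text \<open>
Centering only inside the exponential, not in the quadratic bound, keeps the range condition at
\<open>\<bar>u\<bar> \<le> 1\<close>: integrate \<open>exp u \<le> 1 + u + u\<^sup>2\<close> and use \<open>1 + z \<le> exp z\<close>.
\<close>

lemma (in prob_space) expectation_exp_centered_le:
  fixes u :: "'a \<Rightarrow> real"
  assumes [measurable]: "u \<in> borel_measurable M"
    and bound: "\<And>x. x \<in> space M \<Longrightarrow> \<bar>u x\<bar> \<le> 1"
    and var: "expectation (\<lambda>x. (u x)\<^sup>2) \<le> v"
  shows "expectation (\<lambda>x. exp (u x - expectation u)) \<le> exp v"
proof -
  have int_u: "integrable M u"
    using bound by (intro integrable_const_bound[where B = 1]) auto
  have int_u2: "integrable M (\<lambda>x. (u x)\<^sup>2)"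
    using bound by (intro integrable_const_bound[where B = 1]) (auto simp: abs_square_le_1)
  have int_exp: "integrable M (\<lambda>x. exp (u x))"
    using bound by (intro integrable_const_bound[where B = "exp 1"]) (auto simp: abs_le_iff)
  have "expectation (\<lambda>x. exp (u x)) \<le> expectation (\<lambda>x. 1 + u x + (u x)\<^sup>2)"
    using bound int_u int_u2 int_exp by (intro integral_mono exp_le_quadratic) auto
  also have "\<dots> \<le> 1 + (expectation u + v)"
    using var int_u int_u2 by (simp add: prob_space)
  also have "\<dots> \<le> exp (expectation u + v)"
    by (rule exp_ge_add_one_self)
  finally have *: "expectation (\<lambda>x. exp (u x)) \<le> exp (expectation u + v)" .
  have "expectation (\<lambda>x. exp (u x - expectation u)) = expectation (\<lambda>x. exp (u x)) / exp (expectation u)"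
    by (simp add: exp_diff)
  also have "\<dots> \<le> exp v"
    using * by (simp add: exp_add field_simps)
  finally show ?thesis .
qed

lemma iid_sampleD:
  assumes "prob_space M" "iid_sample M P n X"
  shows "prob_space.indep_vars M (\<lambda>_. P) X {..<n}"
    and "i < n \<Longrightarrow> X i \<in> measurable M P" and "i < n \<Longrightarrow> distr M P (X i) = P"
  using assms unfolding iid_sample_def by (auto simp: prob_space.indep_vars_def)

text \<open>
By independence the exponential moment of the centered sum factorizes into \<open>n\<close> copies of the
one-variable bound.
\<close>

lemma expectation_exp_centered_sum_le:
  fixes u :: "'a \<Rightarrow> real"
  assumes P: "prob_space P" and M: "prob_space M" and iid: "iid_sample M P n X"
    and n: "n \<ge> 1"
    and [measurable]: "u \<in> borel_measurable P"
    and bound: "\<And>x. x \<in> space P \<Longrightarrow> \<bar>u x\<bar> \<le> 1"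
    and var: "(\<integral>x. (u x)\<^sup>2 \<partial>P) \<le> v"
  shows "integrable M (\<lambda>\<omega>. exp ((\<Sum>i<n. u (X i \<omega>)) - real n * (\<integral>x. u x \<partial>P)))"
    and "(\<integral>\<omega>. exp ((\<Sum>i<n. u (X i \<omega>)) - real n * (\<integral>x. u x \<partial>P)) \<partial>M) \<le> exp (real n * v)"
proof -
  interpret P: prob_space P by fact
  interpret M: prob_space M by fact
  note X = iid_sampleD[OF M iid]
  define c where "c = (\<integral>x. u x \<partial>P)"
  define Y where "Y = (\<lambda>i \<omega>. exp (u (X i \<omega>) - c))"
  have prod_eq: "exp ((\<Sum>i<n. u (X i \<omega>)) - real n * c) = (\<Prod>i<n. Y i \<omega>)" for \<omega>
    by (simp add: Y_def exp_sum[symmetric] sum_subtractf)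
  have indep: "M.indep_vars (\<lambda>_. borel) Y {..<n}"
    unfolding Y_def by (rule M.indep_vars_compose2[OF X(1)]) auto
  have intY: "integrable M (Y i)" if "i \<in> {..<n}" for i
  proof -
    have [measurable]: "X i \<in> measurable M P" using X(2) that by simp
    have "\<bar>u (X i \<omega>)\<bar> \<le> 1" if "\<omega> \<in> space M" for \<omega>
      using bound measurable_space[OF \<open>X i \<in> measurable M P\<close> that] by blast
    then show ?thesis unfolding Y_def
      by (intro M.integrable_const_bound[where B = "exp (1 - c)"]) (auto simp: abs_le_iff)
  qed
  have EY: "(\<integral>\<omega>. Y i \<omega> \<partial>M) \<le> exp v" if "i \<in> {..<n}" for i
  proof -
    have [measurable]: "X i \<in> measurable M P" using X(2) that by simp
    have "(\<integral>\<omega>. Y i \<omega> \<partial>M) = (\<integral>x. exp (u x - c) \<partial>distr M P (X i))"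
      unfolding Y_def by (simp add: integral_distr)
    also have "\<dots> \<le> exp v"
      using X(3) that P.expectation_exp_centered_le[OF _ bound var] by (simp add: c_def)
    finally show ?thesis .
  qed
  have fin: "finite {..<n}" by simp
  have "integrable M (\<lambda>\<omega>. \<Prod>i<n. Y i \<omega>)"
    using M.indep_vars_integrable[OF fin indep intY] .
  then show "integrable M (\<lambda>\<omega>. exp ((\<Sum>i<n. u (X i \<omega>)) - real n * (\<integral>x. u x \<partial>P)))"
    unfolding c_def[symmetric] prod_eq .
  have "(\<integral>\<omega>. (\<Prod>i<n. Y i \<omega>) \<partial>M) = (\<Prod>i<n. \<integral>\<omega>. Y i \<omega> \<partial>M)"
    using M.indep_vars_lebesgue_integral[OF fin indep intY] .
  also have "\<dots> \<le> (\<Prod>i<n. exp v)"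
    using EY by (intro prod_mono) (auto intro!: integral_nonneg_AE simp: Y_def)
  also have "\<dots> = exp (real n * v)"
    by (simp add: exp_of_nat_mult[symmetric])
  finally show "(\<integral>\<omega>. exp ((\<Sum>i<n. u (X i \<omega>)) - real n * (\<integral>x. u x \<partial>P)) \<partial>M) \<le> exp (real n * v)"
    unfolding c_def[symmetric] prod_eq .
qed

definition deviation :: "'a measure \<Rightarrow> nat \<Rightarrow> (nat \<Rightarrow> 'a) \<Rightarrow> ('a \<Rightarrow> real) \<Rightarrow> real" where
  "deviation P n x f = \<bar>(\<Sum>i<n. f (x i)) / real n - (\<integral>y. f y \<partial>P)\<bar>"

lemma deviation_nonneg: "0 \<le> deviation P n x f"
  by (simp add: deviation_def)

text \<open>
Replacing \<open>f\<close> by an approximation \<open>g\<close> changes both the empirical mean and the expectation by at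
most the corresponding mean of \<open>T\<close>. This serves twice: \<open>g\<close> is a truncation of \<open>f\<close>, or a link
of the chain that approximates \<open>f\<close>.
\<close>

lemma deviation_truncation_le:
  fixes f :: "'a \<Rightarrow> real"
  assumes x: "\<And>i. i < n \<Longrightarrow> x i \<in> space P" and n: "n \<ge> 1"
    and f: "integrable P f" and g: "integrable P g" and T: "integrable P T"
    and le: "\<And>y. y \<in> space P \<Longrightarrow> \<bar>f y - g y\<bar> \<le> T y"
  shows "deviation P n x f \<le> deviation P n x g + (\<Sum>i<n. T (x i)) / n + (\<integral>y. T y \<partial>P)"
proof -
  have 1: "\<bar>(\<Sum>i<n. f (x i)) / n - (\<Sum>i<n. g (x i)) / n\<bar> \<le> (\<Sum>i<n. T (x i)) / n"
  proof -
    have "\<bar>\<Sum>i<n. f (x i) - g (x i)\<bar> \<le> (\<Sum>i<n. T (x i))"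
      using le x by (intro order_trans[OF sum_abs] sum_mono) auto
    moreover have "\<bar>(\<Sum>i<n. f (x i)) / n - (\<Sum>i<n. g (x i)) / n\<bar> = \<bar>\<Sum>i<n. f (x i) - g (x i)\<bar> / n"
      by (simp add: sum_subtractf diff_divide_distrib[symmetric])
    ultimately show ?thesis by (simp add: divide_right_mono)
  qed
  have "\<bar>(\<integral>y. f y \<partial>P) - (\<integral>y. g y \<partial>P)\<bar> = \<bar>\<integral>y. f y - g y \<partial>P\<bar>"
    using f g by simp
  also have "\<dots> \<le> (\<integral>y. \<bar>f y - g y\<bar> \<partial>P)"
    by (rule integral_abs_bound)
  also have "\<dots> \<le> (\<integral>y. T y \<partial>P)"
    using f g T le by (intro integral_mono) auto
  finally show ?thesis using 1 unfolding deviation_def by linarith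
qed

text \<open>
The tangent of the logarithm at \<open>A\<close>. Taking expectations, a bound \<open>A\<close> on the exponential moment of
\<open>y\<close> becomes the bound \<open>ln A\<close> on its mean, as with Jensen's inequality; being pointwise, the
estimate also supplies a measurable integrable majorant.
\<close>

lemma le_ln_exp_tangent:
  fixes y A :: real
  assumes "A > 0"
  shows "y \<le> ln A - 1 + exp y / A"
proof -
  have "1 + (y - ln A) \<le> exp (y - ln A)" by (rule exp_ge_add_one_self)
  also have "\<dots> = exp y / A" using assms by (simp add: exp_diff)
  finally show ?thesis by simp
qed

text \<open>
The maximum of the truncated deviations is bounded through the sum of their exponential moments,
with both signs to account for the absolute value; hence the factor 2 inside the logarithm. What
the truncation at \<open>t\<close> removes is dominated by \<open>\<beta> G\<close> on \<open>G > t\<close>, once under the empirical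
measure and once under \<open>P\<close>.
\<close>

lemma expected_max_deviation_le:
  fixes H :: "('a \<Rightarrow> real) set" and G :: "'a \<Rightarrow> real"
  assumes P: "prob_space P" and M: "prob_space M" and iid: "iid_sample M P n X"
    and n: "n \<ge> 1"
    and H: "finite H" "H \<noteq> {}" "ln (2 * real (card H)) \<le> real n * \<Lambda>"
    and \<Lambda>: "\<Lambda> > 0" and \<beta>: "\<beta> > 0" and t: "t > 0" and V: "V > 0"
    and G: "integrable P G"
    and meas: "\<And>h. h \<in> H \<Longrightarrow> h \<in> borel_measurable P"
    and env: "\<And>h x. h \<in> H \<Longrightarrow> x \<in> space P \<Longrightarrow> \<bar>h x\<bar> \<le> \<beta> * G x"
    and var: "\<And>h. h \<in> H \<Longrightarrow> (\<integral>x. (if G x \<le> t then (h x)\<^sup>2 else 0) \<partial>P) \<le> V\<^sup>2"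
  shows "(\<integral>\<^sup>+\<omega>. (SUP h\<in>H. ennreal (deviation P n (\<lambda>i. X i \<omega>) h)) \<partial>M)
    \<le> ennreal (2 * V * sqrt \<Lambda> + \<Lambda> * \<beta> * t + 2 * \<beta> * (\<integral>x. (if G x \<le> t then 0 else G x) \<partial>P))"
proof -
  interpret P: prob_space P by fact
  interpret M: prob_space M by fact
  note X = iid_sampleD[OF M iid]
  have [measurable]: "G \<in> borel_measurable P" using G by simp
  \<comment> \<open>Keeps \<open>s * \<beta> * t \<le> 1\<close>, the range of the quadratic bound on \<open>exp\<close>, and balances \<open>\<Lambda> / s\<close> with \<open>s * V\<^sup>2\<close>.\<close>
  define s where "s = 1 / (\<beta> * t + V / sqrt \<Lambda>)"
  have s_pos: "s > 0" using \<Lambda> \<beta> t V by (simp add: s_def add_pos_pos)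
  have s_le: "s * (\<beta> * t) \<le> 1"
    using \<Lambda> \<beta> t V by (simp add: s_def divide_simps add_pos_pos)
  have s_V: "s * V \<le> sqrt \<Lambda>"
  proof -
    have "V / sqrt \<Lambda> \<le> 1 / s" using \<beta> t by (simp add: s_def)
    then show ?thesis using s_pos \<Lambda> by (simp add: field_simps)
  qed
  define tr where "tr = (\<lambda>h x. if G x \<le> t then h x else (0::real))"
  define T where "T = (\<lambda>x. if G x \<le> t then 0 else G x)"
  define A where "A = 2 * real (card H) * exp (real n * (s\<^sup>2 * V\<^sup>2))"
  define e where "e = (\<lambda>h \<omega>. exp ((\<Sum>i<n. s * tr h (X i \<omega>)) - real n * (\<integral>x. s * tr h x \<partial>P))
      + exp ((\<Sum>i<n. - s * tr h (X i \<omega>)) - real n * (\<integral>x. - s * tr h x \<partial>P)))"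
  \<comment> \<open>The integrable majorant of all deviations: tangent bound for the truncated part, plus the tail.\<close>
  define R where "R = (\<lambda>\<omega>. (ln A - 1) / (s * n) + (\<Sum>h\<in>H. e h \<omega>) / (A * (s * n))
      + \<beta> * ((\<Sum>i<n. T (X i \<omega>)) / n + (\<integral>x. T x \<partial>P)))"
  have cardH: "card H \<ge> 1" using H by (simp add: Suc_leI card_gt_0_iff)
  have A_pos: "A > 0" using cardH by (simp add: A_def)
  have Gnn: "0 \<le> G x" if "x \<in> space P" for x
  proof -
    from H obtain h where "h \<in> H" by blast
    then have "0 \<le> \<beta> * G x" using env[OF _ that] by (meson abs_ge_zero order_trans)
    then show ?thesis using \<beta> by (simp add: zero_le_mult_iff)
  qed
  have T: "integrable P T"
    unfolding T_def using Gnn by (intro Bochner_Integration.integrable_bound[OF G]) auto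
  have tr_meas: "tr h \<in> borel_measurable P" if "h \<in> H" for h
    using meas[OF that] unfolding tr_def by measurable
  have tr_bound: "\<bar>tr h x\<bar> \<le> \<beta> * t" if "h \<in> H" "x \<in> space P" for h x
    using env[OF that] \<beta> t by (auto simp: tr_def intro: order_trans mult_left_mono)
  have tr_int: "integrable P (tr h)" if "h \<in> H" for h
    using tr_bound[OF that] tr_meas[OF that]
    by (intro P.integrable_const_bound[where B = "\<beta> * t"]) auto
  have h_int: "integrable P h" if "h \<in> H" for h
    using env[OF that] meas[OF that] G
    by (intro Bochner_Integration.integrable_bound[OF integrable_mult_right[OF G, of \<beta>]])
       (auto intro!: AE_I2 intro: order_trans[OF _ abs_ge_self])
  have e_bound: "integrable M (e h)" "(\<integral>\<omega>. e h \<omega> \<partial>M) \<le> 2 * exp (real n * (s\<^sup>2 * V\<^sup>2))"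
    if h: "h \<in> H" for h
  proof -
    have sm: "(\<integral>x. (c * tr h x)\<^sup>2 \<partial>P) \<le> s\<^sup>2 * V\<^sup>2" if "c\<^sup>2 = s\<^sup>2" for c
    proof -
      have "(\<lambda>x. (c * tr h x)\<^sup>2) = (\<lambda>x. s\<^sup>2 * (if G x \<le> t then (h x)\<^sup>2 else 0))"
        using that by (auto simp: tr_def power_mult_distrib)
      then show ?thesis using var[OF h] by (simp add: mult_left_mono)
    qed
    have bd: "\<bar>c * tr h x\<bar> \<le> 1" if "\<bar>c\<bar> = s" "x \<in> space P" for c x
    proof -
      have "s * \<bar>tr h x\<bar> \<le> s * (\<beta> * t)"
        using tr_bound[OF h that(2)] s_pos by (intro mult_left_mono) auto
      then show ?thesis using s_le that(1) by (simp add: abs_mult)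
    qed
    have ms: "(\<lambda>x. c * tr h x) \<in> borel_measurable P" for c using tr_meas[OF h] by simp
    have abs_s: "\<bar>s\<bar> = s" "\<bar>- s\<bar> = s" using s_pos by auto
    note 1 = expectation_exp_centered_sum_le[OF P M iid n ms bd[OF abs_s(1)] sm[OF refl]]
    note 2 = expectation_exp_centered_sum_le[OF P M iid n ms bd[OF abs_s(2)] sm[OF power2_minus]]
    show "integrable M (e h)" unfolding e_def using 1(1) 2(1) by simp
    show "(\<integral>\<omega>. e h \<omega> \<partial>M) \<le> 2 * exp (real n * (s\<^sup>2 * V\<^sup>2))"
      unfolding e_def using 1 2 by (subst Bochner_Integration.integral_add) auto
  qed
  have TX: "integrable M (\<lambda>\<omega>. T (X i \<omega>))" "(\<integral>\<omega>. T (X i \<omega>) \<partial>M) = (\<integral>x. T x \<partial>P)" if "i < n" for i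
  proof -
    have [measurable]: "X i \<in> measurable M P" "T \<in> borel_measurable P" using X(2) that T by auto
    have "integrable (distr M P (X i)) T" using X(3)[OF that] T by simp
    then show "integrable M (\<lambda>\<omega>. T (X i \<omega>))" by (simp add: integrable_distr_eq)
    have "(\<integral>\<omega>. T (X i \<omega>) \<partial>M) = (\<integral>x. T x \<partial>distr M P (X i))" by (simp add: integral_distr)
    then show "(\<integral>\<omega>. T (X i \<omega>) \<partial>M) = (\<integral>x. T x \<partial>P)" using X(3)[OF that] by simp
  qed
  have dev_le: "deviation P n (\<lambda>i. X i \<omega>) h \<le> R \<omega>" if h: "h \<in> H" and \<omega>: "\<omega> \<in> space M" for h \<omega>
  proof -
    have Xs: "X i \<omega> \<in> space P" if "i < n" for i
      using X(2)[OF that] \<omega> by (rule measurable_space)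
    let ?d = "deviation P n (\<lambda>i. X i \<omega>) (tr h)"
    have "\<bar>h y - tr h y\<bar> \<le> \<beta> * T y" if "y \<in> space P" for y
      using env[OF h that] by (simp add: tr_def T_def)
    from deviation_truncation_le[where T = "\<lambda>y. \<beta> * T y", OF Xs n h_int[OF h] tr_int[OF h] _ this] T
    have 1: "deviation P n (\<lambda>i. X i \<omega>) h \<le> ?d + \<beta> * ((\<Sum>i<n. T (X i \<omega>)) / n + (\<integral>x. T x \<partial>P))"
      by (simp add: sum_distrib_left[symmetric] algebra_simps)
    have "exp (s * n * ?d) \<le> e h \<omega>"
    proof -
      define z where "z = (\<Sum>i<n. tr h (X i \<omega>)) / n - (\<integral>y. tr h y \<partial>P)"
      have "(\<Sum>i<n. s * tr h (X i \<omega>)) - real n * (\<integral>x. s * tr h x \<partial>P) = s * n * z"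
           "(\<Sum>i<n. - s * tr h (X i \<omega>)) - real n * (\<integral>x. - s * tr h x \<partial>P) = - (s * n * z)"
        using n by (simp_all add: z_def sum_distrib_left[symmetric] sum_negf field_simps)
      then have "e h \<omega> = exp (s * n * z) + exp (- (s * n * z))" by (simp add: e_def)
      moreover have "?d = \<bar>z\<bar>" by (simp add: deviation_def z_def)
      ultimately show ?thesis by (cases "z \<ge> 0") (auto simp: add_increasing)
    qed
    also have "\<dots> \<le> (\<Sum>h\<in>H. e h \<omega>)"
      using H h by (intro member_le_sum) (auto simp: e_def add_nonneg_nonneg)
    finally have "s * n * ?d \<le> ln A - 1 + (\<Sum>h\<in>H. e h \<omega>) / A"
      using le_ln_exp_tangent[OF A_pos, of "s * n * ?d"] A_pos
      by (smt (verit) divide_right_mono)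
    then have "?d \<le> (ln A - 1 + (\<Sum>h\<in>H. e h \<omega>) / A) / (s * n)"
      using s_pos n by (simp add: pos_le_divide_eq mult.commute)
    then have "?d \<le> (ln A - 1) / (s * n) + (\<Sum>h\<in>H. e h \<omega>) / (A * (s * n))"
      by (simp add: add_divide_distrib)
    then show ?thesis using 1 unfolding R_def by linarith
  qed
  have sum_e: "integrable M (\<lambda>\<omega>. \<Sum>h\<in>H. e h \<omega>)"
    using e_bound(1) by (rule Bochner_Integration.integrable_sum)
  have sum_T: "integrable M (\<lambda>\<omega>. \<Sum>i<n. T (X i \<omega>))"
    using TX(1) by (intro Bochner_Integration.integrable_sum) simp
  have R_int: "integrable M R"
    unfolding R_def using sum_e sum_T
    by (intro Bochner_Integration.integrable_add integrable_mult_right integrable_divide_zero) auto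
  have R_nn: "0 \<le> R \<omega>" if "\<omega> \<in> space M" for \<omega>
  proof -
    from H obtain h where "h \<in> H" by blast
    then show ?thesis using dev_le[OF _ that] deviation_nonneg by (meson order_trans)
  qed
  have "(\<integral>\<omega>. R \<omega> \<partial>M) = (ln A - 1) / (s * n) + (\<Sum>h\<in>H. \<integral>\<omega>. e h \<omega> \<partial>M) / (A * (s * n))
      + \<beta> * ((\<Sum>i<n. \<integral>x. T x \<partial>P) / n + (\<integral>x. T x \<partial>P))"
    unfolding R_def using sum_e sum_T e_bound(1) TX by (simp add: M.prob_space)
  also have "\<dots> \<le> (ln A - 1) / (s * n) + A / (A * (s * n)) + \<beta> * (2 * (\<integral>x. T x \<partial>P))"
  proof -
    have "(\<Sum>h\<in>H. \<integral>\<omega>. e h \<omega> \<partial>M) \<le> (\<Sum>h\<in>H. 2 * exp (real n * (s\<^sup>2 * V\<^sup>2)))"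
      using e_bound(2) by (rule sum_mono)
    also have "\<dots> = A" by (simp add: A_def)
    finally show ?thesis using A_pos s_pos n
      by (intro add_mono divide_right_mono) auto
  qed
  also have "\<dots> = ln A / (s * n) + 2 * \<beta> * (\<integral>x. T x \<partial>P)"
    using A_pos s_pos n by (simp add: field_simps)
  also have "ln A / (s * n) \<le> \<Lambda> * \<beta> * t + 2 * V * sqrt \<Lambda>"
  proof -
    have "ln A = ln (2 * real (card H)) + n * (s\<^sup>2 * V\<^sup>2)"
      using cardH by (simp add: A_def ln_mult)
    then have "ln A / (s * n) \<le> (n * \<Lambda> + n * (s\<^sup>2 * V\<^sup>2)) / (s * n)"
      using H(3) s_pos n by (intro divide_right_mono) auto
    also have "\<dots> = \<Lambda> * (1 / s) + V * (s * V)"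
      using s_pos n by (simp add: field_simps power2_eq_square)
    also have "\<dots> \<le> \<Lambda> * (\<beta> * t + V / sqrt \<Lambda>) + V * sqrt \<Lambda>"
      using s_V V \<Lambda> by (intro add_mono mult_left_mono) (auto simp: s_def)
    also have "\<dots> = \<Lambda> * \<beta> * t + 2 * V * sqrt \<Lambda>"
    proof -
      have "\<Lambda> * (V / sqrt \<Lambda>) = V * (\<Lambda> / sqrt \<Lambda>)" by simp
      also have "\<dots> = V * sqrt \<Lambda>" using \<Lambda> by (simp add: real_div_sqrt)
      finally show ?thesis by (simp add: distrib_left)
    qed
    finally show ?thesis .
  qed
  finally have ER: "(\<integral>\<omega>. R \<omega> \<partial>M) \<le> 2 * V * sqrt \<Lambda> + \<Lambda> * \<beta> * t + 2 * \<beta> * (\<integral>x. T x \<partial>P)"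
    by linarith
  have "(\<integral>\<^sup>+\<omega>. (SUP h\<in>H. ennreal (deviation P n (\<lambda>i. X i \<omega>) h)) \<partial>M) \<le> (\<integral>\<^sup>+\<omega>. ennreal (R \<omega>) \<partial>M)"
    using dev_le by (intro nn_integral_mono SUP_least ennreal_leI) auto
  also have "\<dots> = ennreal (\<integral>\<omega>. R \<omega> \<partial>M)"
    using R_int R_nn by (intro nn_integral_eq_integral) auto
  also have "\<dots> \<le> ennreal (2 * V * sqrt \<Lambda> + \<Lambda> * \<beta> * t + 2 * \<beta> * (\<integral>x. T x \<partial>P))"
    using ER by (rule ennreal_leI)
  finally show ?thesis unfolding T_def .
qed

section \<open>Finite classes under a moment condition on the envelope\<close>

text \<open>
The level \<open>t = g \<Lambda> powr (-1/m)\<close> balances the two envelope terms: \<open>\<Lambda> \<beta> t\<close> equals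
\<open>\<beta> g \<Lambda> powr (1 - 1/m)\<close>, and the tail expectation of \<open>G\<close> is at most \<open>t powr (1 - m) g powr m\<close>, the same
power of \<open>\<Lambda>\<close>.
\<close>

lemma expected_max_deviation_moment_le:
  fixes H :: "('a \<Rightarrow> real) set" and G :: "'a \<Rightarrow> real"
  assumes P: "prob_space P" and M: "prob_space M" and iid: "iid_sample M P n X"
    and n: "n \<ge> 1"
    and H: "finite H" "H \<noteq> {}" "ln (2 * real (card H)) \<le> real n * \<Lambda>"
    and \<Lambda>: "\<Lambda> > 0" and \<beta>: "\<beta> > 0" and V: "V > 0" and m: "m > 1" and g: "g > 0"
    and G: "integrable P G" and Gnn: "\<And>x. x \<in> space P \<Longrightarrow> 0 \<le> G x"
    and Gm: "integrable P (\<lambda>x. G x powr m)" "(\<integral>x. G x powr m \<partial>P) \<le> g powr m"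
    and meas: "\<And>h. h \<in> H \<Longrightarrow> h \<in> borel_measurable P"
    and env: "\<And>h x. h \<in> H \<Longrightarrow> x \<in> space P \<Longrightarrow> \<bar>h x\<bar> \<le> \<beta> * G x"
    and var: "\<And>h. h \<in> H \<Longrightarrow> (\<integral>x. (if G x \<le> g * \<Lambda> powr (- (1 / m)) then (h x)\<^sup>2 else 0) \<partial>P) \<le> V\<^sup>2"
  shows "(\<integral>\<^sup>+\<omega>. (SUP h\<in>H. ennreal (deviation P n (\<lambda>i. X i \<omega>) h)) \<partial>M)
    \<le> ennreal (2 * V * sqrt \<Lambda> + 3 * \<beta> * g * \<Lambda> powr (1 - 1 / m))"
proof -
  define t where "t = g * \<Lambda> powr (- (1 / m))"
  have t: "t > 0" using g \<Lambda> by (simp add: t_def)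
  have tail: "(\<integral>x. (if G x \<le> t then 0 else G x) \<partial>P) \<le> g * \<Lambda> powr (1 - 1 / m)"
  proof -
    have [measurable]: "G \<in> borel_measurable P" using G by simp
    have "(\<integral>x. (if G x \<le> t then 0 else G x) \<partial>P) \<le> (\<integral>x. t powr (1 - m) * G x powr m \<partial>P)"
    proof (rule integral_mono)
      show "integrable P (\<lambda>x. if G x \<le> t then 0 else G x)"
        using Gnn by (intro Bochner_Integration.integrable_bound[OF G]) auto
      show "integrable P (\<lambda>x. t powr (1 - m) * G x powr m)" using Gm by simp
      show "(if G x \<le> t then 0 else G x) \<le> t powr (1 - m) * G x powr m" if "x \<in> space P" for x
      proof (cases "G x \<le> t")
        case False
        then have "G x powr (1 - m) \<le> t powr (1 - m)" using m t by (intro powr_mono2') auto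
        then have "G x powr (1 - m) * G x powr m \<le> t powr (1 - m) * G x powr m"
          by (intro mult_right_mono) auto
        then show ?thesis using False t by (simp flip: powr_add)
      qed simp
    qed
    also have "\<dots> \<le> t powr (1 - m) * g powr m"
      using Gm by (simp add: mult_left_mono)
    also have "\<dots> = (g powr (1 - m) * g powr m) * \<Lambda> powr (- (1 / m) * (1 - m))"
      using g \<Lambda> by (simp add: t_def powr_mult powr_powr mult_ac)
    also have "- (1 / m) * (1 - m) = 1 - 1 / m" using m by (simp add: field_simps)
    also have "g powr (1 - m) * g powr m = g" using g by (simp flip: powr_add)
    finally show ?thesis .
  qed
  have "\<Lambda> * \<beta> * t = \<beta> * g * (\<Lambda> powr 1 * \<Lambda> powr (- (1 / m)))"
    using \<Lambda> by (simp add: t_def)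
  also have "\<dots> = \<beta> * g * \<Lambda> powr (1 - 1 / m)"
    unfolding powr_add[symmetric] by simp
  finally have 1: "\<Lambda> * \<beta> * t = \<beta> * g * \<Lambda> powr (1 - 1 / m)" .
  have "(\<integral>\<^sup>+\<omega>. (SUP h\<in>H. ennreal (deviation P n (\<lambda>i. X i \<omega>) h)) \<partial>M)
    \<le> ennreal (2 * V * sqrt \<Lambda> + \<Lambda> * \<beta> * t + 2 * \<beta> * (\<integral>x. (if G x \<le> t then 0 else G x) \<partial>P))"
    by (rule expected_max_deviation_le[OF P M iid n H \<Lambda> \<beta> t V G]) (fact meas env var[folded t_def])+
  also have "\<dots> \<le> ennreal (2 * V * sqrt \<Lambda> + 3 * \<beta> * g * \<Lambda> powr (1 - 1 / m))"
    using mult_left_mono[OF tail, of "2 * \<beta>"] \<beta> by (intro ennreal_leI) (simp add: 1)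
  finally show ?thesis .
qed

text \<open>
For \<open>m \<le> 2\<close> the envelope alone bounds the truncated second moment, because
\<open>G\<^sup>2 \<le> t powr (2 - m) G powr m\<close> where \<open>G \<le> t\<close>.
\<close>

lemma expected_max_deviation_envelope_le:
  fixes H :: "('a \<Rightarrow> real) set" and G :: "'a \<Rightarrow> real"
  assumes P: "prob_space P" and M: "prob_space M" and iid: "iid_sample M P n X"
    and n: "n \<ge> 1"
    and H: "finite H" "H \<noteq> {}" "ln (2 * real (card H)) \<le> real n * \<Lambda>"
    and \<Lambda>: "\<Lambda> > 0" and \<beta>: "\<beta> > 0" and m: "m > 1" "m \<le> 2" and g: "g > 0"
    and G: "integrable P G" and Gnn: "\<And>x. x \<in> space P \<Longrightarrow> 0 \<le> G x"
    and Gm: "integrable P (\<lambda>x. G x powr m)" "(\<integral>x. G x powr m \<partial>P) \<le> g powr m"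
    and meas: "\<And>h. h \<in> H \<Longrightarrow> h \<in> borel_measurable P"
    and env: "\<And>h x. h \<in> H \<Longrightarrow> x \<in> space P \<Longrightarrow> \<bar>h x\<bar> \<le> \<beta> * G x"
  shows "(\<integral>\<^sup>+\<omega>. (SUP h\<in>H. ennreal (deviation P n (\<lambda>i. X i \<omega>) h)) \<partial>M)
    \<le> ennreal (5 * \<beta> * g * \<Lambda> powr (1 - 1 / m))"
proof -
  define t where "t = g * \<Lambda> powr (- (1 / m))"
  have t: "t > 0" using g \<Lambda> by (simp add: t_def)
  \<comment> \<open>The square root of \<open>\<beta>\<^sup>2 * t powr (2 - m) * g powr m\<close>.\<close>
  define V where "V = \<beta> * g * \<Lambda> powr (1 / 2 - 1 / m)"
  have V: "V > 0" using \<beta> g \<Lambda> by (simp add: V_def)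
  have var: "(\<integral>x. (if G x \<le> t then (h x)\<^sup>2 else 0) \<partial>P) \<le> V\<^sup>2" if h: "h \<in> H" for h
  proof -
    have [measurable]: "G \<in> borel_measurable P" "h \<in> borel_measurable P" using G meas[OF h] by auto
    have le: "(if G x \<le> t then (h x)\<^sup>2 else 0) \<le> \<beta>\<^sup>2 * t powr (2 - m) * G x powr m" if x: "x \<in> space P" for x
    proof (cases "G x \<le> t \<and> G x > 0")
      case True
      have "(h x)\<^sup>2 \<le> (\<beta> * G x)\<^sup>2" using env[OF h x] by (simp add: abs_le_square_iff[symmetric])
      also have "\<dots> = \<beta>\<^sup>2 * (G x powr (2 - m) * G x powr m)"
        using True by (simp add: power_mult_distrib flip: powr_add)
      also have "\<dots> \<le> \<beta>\<^sup>2 * (t powr (2 - m) * G x powr m)"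
        using True m by (intro mult_left_mono mult_right_mono powr_mono2) auto
      finally show ?thesis using True by (simp add: mult.assoc)
    next
      case False
      then consider "G x > t" | "G x = 0" using Gnn[OF x] by linarith
      then show ?thesis using env[OF h x] t by cases auto
    qed
    have "(\<integral>x. (if G x \<le> t then (h x)\<^sup>2 else 0) \<partial>P) \<le> (\<integral>x. \<beta>\<^sup>2 * t powr (2 - m) * G x powr m \<partial>P)"
    proof (rule integral_mono)
      show int: "integrable P (\<lambda>x. \<beta>\<^sup>2 * t powr (2 - m) * G x powr m)" using Gm by simp
      show "integrable P (\<lambda>x. if G x \<le> t then (h x)\<^sup>2 else 0)"
        using le by (intro Bochner_Integration.integrable_bound[OF int]) (auto intro!: AE_I2)
    qed (rule le)
    also have "\<dots> \<le> \<beta>\<^sup>2 * t powr (2 - m) * g powr m" using Gm by (simp add: mult_left_mono)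
    also have "\<dots> = \<beta>\<^sup>2 * (g powr (2 - m) * g powr m) * \<Lambda> powr (- (1 / m) * (2 - m))"
      using g \<Lambda> by (simp add: t_def powr_mult powr_powr mult_ac)
    also have "\<dots> = \<beta>\<^sup>2 * g\<^sup>2 * \<Lambda> powr (- (1 / m) * (2 - m))"
      using g by (simp flip: powr_add)
    also have "- (1 / m) * (2 - m) = 2 * (1 / 2 - 1 / m)" using m by (simp add: field_simps)
    also have "\<Lambda> powr (2 * (1 / 2 - 1 / m)) = (\<Lambda> powr (1 / 2 - 1 / m))\<^sup>2"
      using \<Lambda> by (simp add: power2_eq_square flip: powr_add)
    finally show ?thesis by (simp add: V_def power_mult_distrib)
  qed
  have "V * sqrt \<Lambda> = \<beta> * g * (\<Lambda> powr (1 / 2 - 1 / m) * \<Lambda> powr (1 / 2))"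
    using \<Lambda> by (simp add: V_def powr_half_sqrt)
  also have "\<dots> = \<beta> * g * \<Lambda> powr (1 - 1 / m)"
    unfolding powr_add[symmetric] by simp
  finally have eq: "2 * V * sqrt \<Lambda> + 3 * \<beta> * g * \<Lambda> powr (1 - 1 / m) = 5 * \<beta> * g * \<Lambda> powr (1 - 1 / m)"
    by simp
  show ?thesis unfolding eq[symmetric]
    by (rule expected_max_deviation_moment_le[OF P M iid n H \<Lambda> \<beta> V m(1) g G])
      (fact Gnn Gm meas env var[unfolded t_def])+
qed

section \<open>Covering radii selected from an entropy integral\<close>

lemma covering_number_finite_covering:
  assumes "covering_number x K d = enat j"
  obtains C where "finite C" "is_covering x K d C" "card C = j"
proof -
  let ?S = "{C. finite C \<and> is_covering x K d C}"
  have "?S \<noteq> {}"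
  proof
    assume empty: "?S = {}"
    have "covering_number x K d = \<infinity>" unfolding covering_number_def empty by (simp add: top_enat_def)
    then show False using assms by simp
  qed
  then have "covering_number x K d \<in> (\<lambda>C. enat (card C)) ` ?S"
    unfolding covering_number_def by (meson all_not_in_conv image_eqI wellorder_InfI)
  then show ?thesis using that assms by auto
qed

text \<open>
This turns the absence of small coverings into a lower bound for the entropy integrand; it also
covers the case of no finite covering at all.
\<close>

lemma ln_covering_number_ge:
  assumes "\<And>C. finite C \<Longrightarrow> is_covering x K d C \<Longrightarrow> a < ln (real (card C))"
  shows "ennreal a \<le> ln_enat (covering_number x K d)"
proof (cases "covering_number x K d")
  case (enat j)
  then obtain C where "finite C" "is_covering x K d C" "card C = j"
    by (rule covering_number_finite_covering)
  then show ?thesis using assms[of C] enat by (simp add: ln_enat_def ennreal_leI)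
qed (simp add: ln_enat_def)

lemma epowr_mono_ennreal:
  assumes "0 < q" "0 \<le> a" "ennreal a \<le> z"
  shows "ennreal (a powr q) \<le> epowr z q"
proof (cases z)
  case (real r)
  then show ?thesis using assms by (auto simp: epowr_def intro!: ennreal_leI powr_mono2)
qed (use assms in \<open>simp add: epowr_def\<close>)

lemma is_covering_mono:
  assumes "is_covering x K d C" "x \<le> y"
  shows "is_covering y K d C"
  using assms unfolding is_covering_def by (meson ennreal_leI order_trans)

text \<open>
Let \<open>\<rho> k\<close> be the infimum of the radii at which a covering with log-cardinality at most \<open>L 4\<^sup>k\<close> exists. Below
\<open>\<rho> k\<close> the entropy exceeds \<open>L 4\<^sup>k\<close>, so the integrand dominates the step function that jumps by
\<open>(L 4\<^sup>k) powr q - (L 4\<^sup>k\<^sup>-\<^sup>1) powr q\<close> at each \<open>\<rho> k\<close>, and the integral of that function is the sum of the jumps times the \<open>\<rho> k\<close>. The constant 1 in the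
integrand contributes \<open>2 D\<close>: one half remains in the conclusion, the other half pays for enlarging
\<open>\<rho> k\<close>, at which a covering need not exist, to an admissible radius \<open>r k\<close>.
\<close>

lemma entropy_radii:
  fixes K :: "'b set" and d :: "'b \<Rightarrow> 'b \<Rightarrow> ennreal"
  assumes q: "0 < q" and D: "0 < D" and L: "0 < L" and K: "K \<noteq> {}"
    and diam: "\<And>f g. f \<in> K \<Longrightarrow> g \<in> K \<Longrightarrow> d f g \<le> ennreal (2 * D)"
    and J: "0 \<le> J" "entropy_integral K d q (ennreal (2 * D)) \<le> ennreal J"
  obtains r :: "nat \<Rightarrow> real" and C where
    "\<And>k. 0 < r k" "\<And>k. finite (C k)" "\<And>k. is_covering (r k) K d (C k)"
    "\<And>k. ln (real (card (C k))) \<le> L * 4 ^ k"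
    "\<And>N. (1 - 1 / 4 powr q) * (\<Sum>k<N. r k * (L * 4 ^ k) powr q) + D \<le> J"
proof -
  define bad where "bad k x \<longleftrightarrow> (\<forall>C. finite C \<longrightarrow> is_covering x K d C \<longrightarrow> L * 4 ^ k < ln (real (card C)))"
    for k :: nat and x
  \<comment> \<open>Inserting 0 makes the supremum 0 when a covering exists at every positive radius.\<close>
  define S where "S k = insert 0 {x. 0 < x \<and> x \<le> 2 * D \<and> bad k x}" for k
  define \<rho> where "\<rho> k = Sup (S k)" for k
  define c where "c k = (L * 4 ^ k) powr q * (1 - 1 / 4 powr q)" for k :: nat
  \<comment> \<open>The enlargement is weighted so that its total contribution to the weighted sum is below \<open>D\<close>.\<close>
  define r where "r k = \<rho> k + D / (2 ^ Suc k * c k)" for k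
  have one_less: "1 < 4 powr q" using q by (simp add: gr_one_powr)
  have c_pos: "0 < c k" for k using L one_less by (simp add: c_def)
  have bdd: "bdd_above (S k)" for k
    by (rule bdd_aboveI[where M = "2 * D"]) (use D in \<open>auto simp: S_def\<close>)
  have \<rho>: "0 \<le> \<rho> k" "\<rho> k \<le> 2 * D" for k
    unfolding \<rho>_def using bdd D
    by (auto intro: cSup_upper cSup_least simp: S_def)
  have bad_below: "bad k x" if x: "0 < x" "x < \<rho> k" for k x
  proof -
    have "S k \<noteq> {}" by (simp add: S_def)
    then obtain y where "y \<in> S k" "x < y"
      using x(2) bdd less_cSup_iff unfolding \<rho>_def by metis
    then show ?thesis using x(1) is_covering_mono[of x K d _ y] by (auto simp: S_def bad_def)
  qed
  have \<rho>_less: "\<rho> k < r k" for k using D c_pos[of k] by (simp add: r_def)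
  have "\<exists>C. finite C \<and> is_covering (r k) K d C \<and> ln (real (card C)) \<le> L * 4 ^ k" for k
  proof (cases "r k \<le> 2 * D")
    case True
    have "r k \<notin> S k"
      using \<rho>_less[of k] cSup_upper[OF _ bdd[of k]] unfolding \<rho>_def by (meson not_le)
    then have "\<not> bad k (r k)" using True \<rho>[of k] \<rho>_less[of k] by (simp add: S_def)
    then show ?thesis by (auto simp: bad_def not_less)
  next
    case False
    \<comment> \<open>Beyond the diameter a single point is a covering.\<close>
    obtain f where f: "f \<in> K" using K by blast
    have "is_covering (2 * D) K d {f}" using f diam by (simp add: is_covering_def)
    then have "is_covering (r k) K d {f}" using False by (elim is_covering_mono) auto
    then show ?thesis using L by (intro exI[of _ "{f}"]) auto
  qed
  then obtain C where C: "finite (C k)" "is_covering (r k) K d (C k)"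
    "ln (real (card (C k))) \<le> L * 4 ^ k" for k by metis
  have telescope: "(\<Sum>k<Suc N. c k) \<le> (L * 4 ^ N) powr q" for N
  proof (induction N)
    case 0
    have "c 0 \<le> L powr q * 1" unfolding c_def using one_less by (intro mult_mono) auto
    then show ?case by simp
  next
    case (Suc N)
    have "(L * 4 ^ Suc N) powr q = 4 powr q * (L * 4 ^ N) powr q"
      using L by (simp add: powr_mult)
    then have "c (Suc N) = (L * 4 ^ Suc N) powr q - (L * 4 ^ N) powr q"
      using one_less by (simp add: c_def field_simps)
    then show ?case using Suc by simp
  qed
  define E where "E x = epowr (ln_enat (covering_number x K d)) q" for x
  have pointwise: "(\<Sum>k<N. ennreal (c k) * indicator {0<..<\<rho> k} x) \<le> E x" for x N
  proof (induction N)
    case (Suc N)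
    show ?case
    proof (cases "x \<in> {0<..<\<rho> N}")
      case True
      have "(\<Sum>k<Suc N. ennreal (c k) * indicator {0<..<\<rho> k} x) \<le> (\<Sum>k<Suc N. ennreal (c k))"
        by (intro sum_mono) (auto simp: indicator_def)
      also have "\<dots> = ennreal (\<Sum>k<Suc N. c k)"
        using c_pos by (intro sum_ennreal) (auto intro: less_imp_le)
      also have "\<dots> \<le> ennreal ((L * 4 ^ N) powr q)"
        using telescope by (rule ennreal_leI)
      also have "\<dots> \<le> E x"
        unfolding E_def using bad_below[of x N] True L q
        by (intro epowr_mono_ennreal ln_covering_number_ge) (auto simp: bad_def)
      finally show ?thesis .
    next
      case False
      then show ?thesis using Suc by simp
    qed
  qed simp
  have main: "(\<Sum>k<N. c k * \<rho> k) + 2 * D \<le> J" for N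
  proof -
    have "ennreal ((\<Sum>k<N. c k * \<rho> k) + 2 * D) = (\<Sum>k<N. ennreal (c k) * ennreal (\<rho> k)) + ennreal (2 * D)"
      using c_pos \<rho>(1) D
      by (simp add: ennreal_mult[symmetric] less_imp_le sum_nonneg)
    also have "\<dots> = (\<integral>\<^sup>+x. (\<Sum>k<N. ennreal (c k) * indicator {0<..<\<rho> k} x) + indicator {0<..2*D} x \<partial>lborel)"
    proof -
      have "(\<integral>\<^sup>+x. (\<Sum>k<N. ennreal (c k) * indicator {0<..<\<rho> k} x) + indicator {0<..2*D} x \<partial>lborel)
        = (\<integral>\<^sup>+x. (\<Sum>k<N. ennreal (c k) * indicator {0<..<\<rho> k} x) \<partial>lborel) + (\<integral>\<^sup>+x. indicator {0<..2*D} x \<partial>lborel)"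
        by (rule nn_integral_add) measurable
      also have "(\<integral>\<^sup>+x. (\<Sum>k<N. ennreal (c k) * indicator {0<..<\<rho> k} x) \<partial>lborel)
        = (\<Sum>k<N. \<integral>\<^sup>+x. ennreal (c k) * indicator {0<..<\<rho> k} x \<partial>lborel)"
        by (rule nn_integral_sum) measurable
      also have "\<dots> = (\<Sum>k<N. ennreal (c k) * ennreal (\<rho> k))"
        using \<rho>(1) by (simp add: nn_integral_cmult_indicator)
      finally show ?thesis using D by simp
    qed
    also have "\<dots> \<le> entropy_integral K d q (ennreal (2 * D))"
      unfolding entropy_integral_def
    proof (rule nn_integral_mono)
      fix x :: real
      have "(\<Sum>k<N. ennreal (c k) * indicator {0<..<\<rho> k} x) = 0" if "\<not> (0 < x \<and> x \<le> 2 * D)"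
      proof (intro sum.neutral ballI)
        fix k
        show "ennreal (c k) * indicator {0<..<\<rho> k} x = 0"
          using that \<rho>(2)[of k] by (auto simp: indicator_def)
      qed
      then show "(\<Sum>k<N. ennreal (c k) * indicator {0<..<\<rho> k} x) + indicator {0<..2*D} x
        \<le> (1 + epowr (ln_enat (covering_number x K d)) q) * indicator {x. 0 < x \<and> ennreal x \<le> ennreal (2 * D)} x"
        using pointwise[of x N] D by (auto simp: indicator_def E_def add.commute intro: add_mono)
    qed
    also have "\<dots> \<le> ennreal J" by (rule J)
    finally show ?thesis using J(1) by (simp add: ennreal_le_iff)
  qed
  have final: "(1 - 1 / 4 powr q) * (\<Sum>k<N. r k * (L * 4 ^ k) powr q) + D \<le> J" for N
  proof -
    have "(1 - 1 / 4 powr q) * (\<Sum>k<N. r k * (L * 4 ^ k) powr q) = (\<Sum>k<N. c k * r k)"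
      by (simp add: c_def sum_distrib_left mult_ac)
    also have "\<dots> = (\<Sum>k<N. c k * \<rho> k + D * (1 / 2) ^ Suc k)"
    proof (intro sum.cong refl)
      fix k show "c k * r k = c k * \<rho> k + D * (1 / 2) ^ Suc k"
        using c_pos[of k] by (simp add: r_def field_simps power_divide)
    qed
    also have "\<dots> = (\<Sum>k<N. c k * \<rho> k) + D * (\<Sum>k<N. (1 / 2) ^ Suc k)"
      by (simp add: sum.distrib sum_distrib_left)
    also have "(\<Sum>k<N. (1 / 2) ^ Suc k) = 1 - (1 / 2 :: real) ^ N"
      by (induction N) (auto simp: field_simps)
    finally show ?thesis using main[of N] D by (simp add: algebra_simps) (smt (verit) D mult_pos_pos zero_less_divide_1_iff zero_less_power)
  qed
  have r_pos: "0 < r k" for k using \<rho>(1)[of k] \<rho>_less[of k] by linarith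
  show ?thesis by (rule that[of r C]) (use r_pos C final in auto)
qed

section \<open>Links between successive approximations\<close>

text \<open>
Symmetry and the triangle inequality in terms of positive real bounds. This form suits the
\<open>L\<^sup>2\<close> norm, whose triangle inequality is proved with weights depending on these bounds.
\<close>

definition radii_add :: "'b set \<Rightarrow> ('b \<Rightarrow> 'b \<Rightarrow> ennreal) \<Rightarrow> bool" where
  "radii_add K d \<longleftrightarrow> (\<forall>f\<in>K. \<forall>g\<in>K. d f g = d g f) \<and>
    (\<forall>f\<in>K. \<forall>g\<in>K. \<forall>h\<in>K. \<forall>r>0. \<forall>s>0.
      d f g \<le> ennreal r \<longrightarrow> d g h \<le> ennreal s \<longrightarrow> d f h \<le> ennreal (r + s))"

lemma radii_addD:
  assumes "radii_add K d" "f \<in> K" "g \<in> K" "h \<in> K" "0 < r" "0 < s"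
    and "d f g \<le> ennreal r" "d h g \<le> ennreal s"
  shows "d f h \<le> ennreal (r + s)"
  using assms unfolding radii_add_def by metis

text \<open>
A centre close to \<open>f\<close> in one distance may be far away in the other. Instead, one member is picked
from each nonempty intersection of a cell of the first covering with a cell of the second; two
members of such an intersection are within twice the radius in both distances.
\<close>

lemma common_cell_representatives:
  assumes add: "radii_add K d1" "radii_add K d2"
    and C: "finite C" "is_covering a K d1 C" and D: "finite D" "is_covering b K d2 D"
    and pos: "0 < a" "0 < b"
  obtains \<pi> where "\<And>f. f \<in> K \<Longrightarrow> \<pi> f \<in> K" "finite (\<pi> ` K)" "card (\<pi> ` K) \<le> card C * card D"
    "\<And>f. f \<in> K \<Longrightarrow> d1 f (\<pi> f) \<le> ennreal (a + a)" "\<And>f. f \<in> K \<Longrightarrow> d2 f (\<pi> f) \<le> ennreal (b + b)"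
proof -
  obtain c where c: "\<And>f. f \<in> K \<Longrightarrow> c f \<in> C \<and> d1 f (c f) \<le> ennreal a"
    using C(2) unfolding is_covering_def by metis
  obtain e where e: "\<And>f. f \<in> K \<Longrightarrow> e f \<in> D \<and> d2 f (e f) \<le> ennreal b"
    using D(2) unfolding is_covering_def by metis
  have CD: "C \<subseteq> K" "D \<subseteq> K" using C D by (auto simp: is_covering_def)
  define rep where "rep p = (SOME g. g \<in> K \<and> (c g, e g) = p)" for p
  define \<pi> where "\<pi> f = rep (c f, e f)" for f
  have \<pi>: "\<pi> f \<in> K" "c (\<pi> f) = c f" "e (\<pi> f) = e f" if "f \<in> K" for f
    using someI[of "\<lambda>g. g \<in> K \<and> (c g, e g) = (c f, e f)" f] that by (auto simp: \<pi>_def rep_def)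
  have sub: "\<pi> ` K \<subseteq> rep ` (C \<times> D)" using c e by (auto simp: \<pi>_def)
  have fin: "finite (C \<times> D)" using C D by simp
  have "card (\<pi> ` K) \<le> card (rep ` (C \<times> D))" using sub fin by (intro card_mono) auto
  also have "\<dots> \<le> card (C \<times> D)" using fin by (rule card_image_le)
  finally have card: "card (\<pi> ` K) \<le> card C * card D" by (simp add: card_cartesian_product)
  have "d1 f (\<pi> f) \<le> ennreal (a + a)" if f: "f \<in> K" for f
    using c[OF f] c[OF \<pi>(1)[OF f]] \<pi>[OF f] f CD pos
    by (intro radii_addD[OF add(1), of f "c f"]) auto
  moreover have "d2 f (\<pi> f) \<le> ennreal (b + b)" if f: "f \<in> K" for f
    using e[OF f] e[OF \<pi>(1)[OF f]] \<pi>[OF f] f CD pos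
    by (intro radii_addD[OF add(2), of f "e f"]) auto
  ultimately show ?thesis
    using that[of \<pi>] \<pi>(1) finite_subset[OF sub] fin card by blast
qed

text \<open>
The link at level 0 starts from the zero function rather than from a member of the class, so that
the links telescope to the approximation itself.
\<close>

definition chain_link :: "(nat \<Rightarrow> 'f \<Rightarrow> 'a \<Rightarrow> real) \<Rightarrow> nat \<Rightarrow> 'f \<Rightarrow> 'a \<Rightarrow> real" where
  "chain_link \<pi> k f = (case k of 0 \<Rightarrow> \<pi> 0 f | Suc j \<Rightarrow> (\<lambda>x. \<pi> (Suc j) f x - \<pi> j f x))"

lemma sum_chain_link: "(\<Sum>k<Suc N. chain_link \<pi> k f x) = \<pi> N f x"
  by (induction N) (auto simp: chain_link_def)

text \<open>
A link at level \<open>k\<close> is determined by two representatives, so twice the number of links has logarithm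
at most \<open>ln 2 + 4 \<cdot> 4\<^sup>k + 4\<^sup>k\<close>; at level 0 the last term is absent. Both are below \<open>5.2 \<cdot> 4\<^sup>k\<close>.
\<close>

lemma ln_card_chain_link_le:
  assumes fin: "\<And>k. finite (\<pi> k ` K)" and "K \<noteq> {}"
    and ln: "\<And>k. ln (real (card (\<pi> k ` K))) \<le> 4 * 4 ^ k"
  shows "finite (chain_link \<pi> k ` K)" and "ln (2 * real (card (chain_link \<pi> k ` K))) \<le> 5.2 * 4 ^ k"
proof -
  have ln2: "ln (2::real) \<le> 7 / 10" using ln2_le_25_over_36 by linarith
  have pos: "0 < card (\<pi> k ` K)" for k using fin \<open>K \<noteq> {}\<close> by (simp add: card_gt_0_iff)
  have "finite (chain_link \<pi> k ` K) \<and> ln (2 * real (card (chain_link \<pi> k ` K))) \<le> 5.2 * 4 ^ k"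
  proof (cases k)
    case 0
    have "chain_link \<pi> k ` K = \<pi> 0 ` K" using 0 by (simp add: chain_link_def)
    then show ?thesis using fin[of 0] pos[of 0] ln[of 0] ln2 0 by (simp add: ln_mult)
  next
    case (Suc j)
    let ?D = "\<lambda>p x. fst p x - snd p x :: real"
    have sub: "chain_link \<pi> k ` K \<subseteq> ?D ` (\<pi> (Suc j) ` K \<times> \<pi> j ` K)"
    proof
      fix h assume "h \<in> chain_link \<pi> k ` K"
      then obtain f where "f \<in> K" "h = ?D (\<pi> (Suc j) f, \<pi> j f)" using Suc by (auto simp: chain_link_def)
      then show "h \<in> ?D ` (\<pi> (Suc j) ` K \<times> \<pi> j ` K)" by blast
    qed
    have finp: "finite (\<pi> (Suc j) ` K \<times> \<pi> j ` K)" using fin by blast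
    have f: "finite (chain_link \<pi> k ` K)" using finite_subset[OF sub] finp by blast
    have "card (chain_link \<pi> k ` K) \<le> card (\<pi> (Suc j) ` K \<times> \<pi> j ` K)"
      using card_mono[OF _ sub] card_image_le[OF finp, of ?D] finp by (meson finite_imageI order_trans)
    then have le: "card (chain_link \<pi> k ` K) \<le> card (\<pi> (Suc j) ` K) * card (\<pi> j ` K)"
      by (simp add: card_cartesian_product)
    have "0 < card (chain_link \<pi> k ` K)" using f \<open>K \<noteq> {}\<close> by (simp add: card_gt_0_iff)
    then have "ln (2 * real (card (chain_link \<pi> k ` K)))
      \<le> ln (2 * (real (card (\<pi> (Suc j) ` K)) * real (card (\<pi> j ` K))))"
      using le by (subst ln_le_cancel_iff) (auto simp: pos simp flip: of_nat_mult)
    also have "\<dots> = ln 2 + ln (real (card (\<pi> (Suc j) ` K))) + ln (real (card (\<pi> j ` K)))"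
      using pos by (simp add: ln_mult)
    also have "\<dots> \<le> 5.2 * 4 ^ k"
    proof -
      have "1 \<le> (4::real) ^ j" by simp
      then show ?thesis using ln[of j] ln[of "Suc j"] ln2 unfolding Suc power_Suc by linarith
    qed
    finally show ?thesis using f by simp
  qed
  then show "finite (chain_link \<pi> k ` K)" "ln (2 * real (card (chain_link \<pi> k ` K))) \<le> 5.2 * 4 ^ k"
    by auto
qed

lemma deviation_sum_le:
  assumes "\<And>k. k < N \<Longrightarrow> integrable P (h k)"
  shows "deviation P n x (\<lambda>y. \<Sum>k<N. h k y) \<le> (\<Sum>k<N. deviation P n x (h k))"
proof -
  have "(\<Sum>i<n. \<Sum>k<N. h k (x i)) / real n - (\<integral>y. (\<Sum>k<N. h k y) \<partial>P)
    = (\<Sum>k<N. (\<Sum>i<n. h k (x i)) / real n - (\<integral>y. h k y \<partial>P))"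
    using assms by (subst sum.swap) (simp add: Bochner_Integration.integral_sum sum_subtractf sum_divide_distrib)
  then show ?thesis unfolding deviation_def by (simp add: sum_abs)
qed

lemma sup_deviation_empirical:
  assumes "\<And>i. i < n \<Longrightarrow> x i \<in> space P" and "\<And>f. f \<in> \<F> \<Longrightarrow> f \<in> borel_measurable P"
  shows "sup_deviation (empirical_measure P n x) P \<F> = (SUP f\<in>\<F>. ennreal (deviation P n x f))"
  unfolding sup_deviation_def deviation_def using assms
  by (intro SUP_cong refl) (simp add: integral_empirical_measure)

lemma deviation_measurable:
  assumes "\<And>i. i < n \<Longrightarrow> X i \<in> measurable M P" and "f \<in> borel_measurable P"
  shows "(\<lambda>\<omega>. deviation P n (\<lambda>i. X i \<omega>) f) \<in> borel_measurable M"
proof -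
  have [measurable]: "(\<lambda>\<omega>. f (X i \<omega>)) \<in> borel_measurable M" if "i \<in> {..<n}" for i
    using measurable_compose[OF assms(1) assms(2)] that by simp
  show ?thesis unfolding deviation_def by measurable
qed

lemma ennreal_add_le:
  assumes "0 \<le> a"
  shows "ennreal (a + b) \<le> ennreal a + ennreal b"
  using assms by (cases "0 \<le> b") (auto simp: ennreal_neg intro: ennreal_leI)

text \<open>
For each sample point the deviation of \<open>f\<close> is at most the sum of the deviations of its links plus
an error proportional to \<open>\<delta> N\<close>, which vanishes in the limit. Since each level contains finitely
many links, the series of their maxima is a measurable majorant of the supremum, however large
the class is; this is what bounds the outer expectation.
\<close>

lemma outer_expectation_chaining:
  fixes \<F> :: "('a \<Rightarrow> real) set" and G :: "'a \<Rightarrow> real"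
  assumes P: "prob_space P" and M: "prob_space M" and iid: "iid_sample M P n X"
    and n: "n \<ge> 1" and G: "integrable P G"
    and meas: "\<And>f. f \<in> \<F> \<Longrightarrow> f \<in> borel_measurable P"
    and env: "\<And>f x. f \<in> \<F> \<Longrightarrow> x \<in> space P \<Longrightarrow> \<bar>f x\<bar> \<le> b * G x"
    and \<pi>: "\<And>k f. f \<in> \<F> \<Longrightarrow> \<pi> k f \<in> \<F>" and fin: "\<And>k. finite (chain_link \<pi> k ` \<F>)"
    and close: "\<And>k f x. f \<in> \<F> \<Longrightarrow> x \<in> space P \<Longrightarrow> \<bar>f x - \<pi> k f x\<bar> \<le> \<delta> k * G x"
    and \<delta>: "\<delta> \<longlonglongrightarrow> 0"
  shows "outer_expectation M (\<lambda>\<omega>. sup_deviation (empirical_measure P n (\<lambda>i. X i \<omega>)) P \<F>)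
    \<le> (\<Sum>k. \<integral>\<^sup>+\<omega>. (SUP h\<in>chain_link \<pi> k ` \<F>. ennreal (deviation P n (\<lambda>i. X i \<omega>) h)) \<partial>M)"
proof -
  note X = iid_sampleD[OF M iid]
  define Z where "Z k \<omega> = (SUP h\<in>chain_link \<pi> k ` \<F>. ennreal (deviation P n (\<lambda>i. X i \<omega>) h))" for k \<omega>
  have f_int: "integrable P f" if "f \<in> \<F>" for f
    using env[OF that] meas[OF that] G
    by (intro Bochner_Integration.integrable_bound[OF integrable_mult_right[OF G, of b]])
       (auto intro!: AE_I2 intro: order_trans[OF _ abs_ge_self])
  have link_int: "integrable P (chain_link \<pi> k f)" if "f \<in> \<F>" for k f
    using f_int[OF \<pi>[OF that]] by (cases k) (auto simp: chain_link_def)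
  have Z_meas: "Z k \<in> borel_measurable M" for k
  proof -
    have "(\<lambda>\<omega>. ennreal (deviation P n (\<lambda>i. X i \<omega>) h)) \<in> borel_measurable M"
      if "h \<in> chain_link \<pi> k ` \<F>" for h
    proof -
      have "h \<in> borel_measurable P" using link_int that by (auto dest: borel_measurable_integrable)
      then show ?thesis
        using deviation_measurable[OF X(2)] by (intro measurable_compose[OF _ measurable_ennreal])
    qed
    then show ?thesis unfolding Z_def using fin
      by (intro borel_measurable_SUP) (auto intro: countable_finite)
  qed
  have "sup_deviation (empirical_measure P n (\<lambda>i. X i \<omega>)) P \<F> \<le> (\<Sum>k. Z k \<omega>)" if \<omega>: "\<omega> \<in> space M" for \<omega>
  proof -
    have Xs: "X i \<omega> \<in> space P" if "i < n" for i
      using X(2)[OF that] \<omega> by (rule measurable_space)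
    let ?dev = "deviation P n (\<lambda>i. X i \<omega>)"
    define c where "c = (\<Sum>i<n. G (X i \<omega>)) / n + (\<integral>x. G x \<partial>P)"
    have "ennreal (?dev f) \<le> (\<Sum>k. Z k \<omega>)" if f: "f \<in> \<F>" for f
    proof -
      have step: "ennreal (?dev f) \<le> (\<Sum>k. Z k \<omega>) + ennreal (\<delta> N * c)" for N
      proof -
        have "?dev f \<le> ?dev (\<pi> N f) + (\<Sum>i<n. \<delta> N * G (X i \<omega>)) / n + (\<integral>x. \<delta> N * G x \<partial>P)"
          using Xs n f_int[OF f] f_int[OF \<pi>[OF f]] G close[OF f]
          by (intro deviation_truncation_le) auto
        then have 1: "?dev f \<le> ?dev (\<pi> N f) + \<delta> N * c"
          by (simp add: c_def sum_distrib_left[symmetric] algebra_simps)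
        have "?dev (\<pi> N f) = ?dev (\<lambda>x. \<Sum>k<Suc N. chain_link \<pi> k f x)"
          by (subst sum_chain_link) simp
        also have "\<dots> \<le> (\<Sum>k<Suc N. ?dev (chain_link \<pi> k f))"
          using link_int[OF f] by (intro deviation_sum_le)
        finally have "?dev f \<le> (\<Sum>k<Suc N. ?dev (chain_link \<pi> k f)) + \<delta> N * c" using 1 by linarith
        then have "ennreal (?dev f) \<le> ennreal (\<Sum>k<Suc N. ?dev (chain_link \<pi> k f)) + ennreal (\<delta> N * c)"
          by (meson ennreal_leI ennreal_add_le deviation_nonneg order_trans sum_nonneg)
        also have "ennreal (\<Sum>k<Suc N. ?dev (chain_link \<pi> k f)) = (\<Sum>k<Suc N. ennreal (?dev (chain_link \<pi> k f)))"
          by (simp add: deviation_nonneg sum_ennreal del: sum.lessThan_Suc)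
        also have "\<dots> \<le> (\<Sum>k<Suc N. Z k \<omega>)"
          unfolding Z_def using f by (intro sum_mono SUP_upper) auto
        also have "\<dots> \<le> (\<Sum>k. Z k \<omega>)"
          by (intro sum_le_suminf) auto
        finally show ?thesis by (simp add: add_right_mono)
      qed
      have "(\<lambda>N. \<delta> N * c) \<longlonglongrightarrow> 0 * c" using \<delta> by (intro tendsto_intros)
      then have "(\<lambda>N. (\<Sum>k. Z k \<omega>) + ennreal (\<delta> N * c)) \<longlonglongrightarrow> (\<Sum>k. Z k \<omega>) + ennreal (0 * c)"
        by (intro tendsto_add tendsto_const tendsto_ennrealI)
      then have "ennreal (?dev f) \<le> (\<Sum>k. Z k \<omega>) + ennreal (0 * c)"
        by (rule LIMSEQ_le_const) (use step in blast)
      then show ?thesis by simp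
    qed
    then show ?thesis
      using Xs meas by (simp add: sup_deviation_empirical SUP_le_iff)
  qed
  then have "outer_expectation M (\<lambda>\<omega>. sup_deviation (empirical_measure P n (\<lambda>i. X i \<omega>)) P \<F>)
    \<le> (\<integral>\<^sup>+\<omega>. (\<Sum>k. Z k \<omega>) \<partial>M)"
    unfolding outer_expectation_def using Z_meas by (intro INF_lower) auto
  also have "\<dots> = (\<Sum>k. \<integral>\<^sup>+\<omega>. Z k \<omega> \<partial>M)"
    using Z_meas by (rule nn_integral_suminf)
  finally show ?thesis unfolding Z_def .
qed

section \<open>Summing the links against the entropy integrals\<close>

text \<open>
Two successive representatives of \<open>f\<close> are within \<open>2 r j\<close> and \<open>2 r (Suc j)\<close> of it; the initial link
is a member of the class, of norm at most \<open>D\<close>.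
\<close>

definition link_radius :: "real \<Rightarrow> (nat \<Rightarrow> real) \<Rightarrow> nat \<Rightarrow> real" where
  "link_radius D r k = (case k of 0 \<Rightarrow> D | Suc j \<Rightarrow> 2 * (r j + r (Suc j)))"

text \<open>
With \<open>y = 4 powr q\<close>, shifting the index in the terms \<open>r j\<close> costs a factor \<open>y\<close>, whence \<open>2 (y + 1)\<close> times
the weighted sum of the radii. The initial term is absorbed by the summand \<open>D\<close> in the hypothesis,
and \<open>2.6 = 5.2 / 2\<close> compares the cardinality of the links with that of the coverings.
\<close>

lemma link_radius_sum_le:
  fixes q D J :: real
  assumes q: "0 < q" "q \<le> 1" and D: "0 < D" and r: "\<And>k. 0 < r k"
    and J: "\<And>N. (1 - 1 / 4 powr q) * (\<Sum>k<N. r k * (2 * 4 ^ k) powr q) + D \<le> J"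
  shows "(\<Sum>k<N. link_radius D r k * (5.2 * 4 ^ k) powr q)
    \<le> 2.6 powr q * (2 * (4 powr q + 1) / (1 - 1 / 4 powr q)) * J"
proof -
  define y where "y = 4 powr q"
  have y: "1 < y" using q by (simp add: y_def gr_one_powr)
  define R where "R k = (2 * 4 ^ k :: real) powr q" for k :: nat
  have R_Suc: "R (Suc k) = y * R k" for k
  proof -
    have "2 * 4 ^ Suc k = 4 * (2 * 4 ^ k :: real)" by simp
    then show ?thesis unfolding R_def y_def by (metis powr_mult)
  qed
  have R_pos: "0 < R k" for k by (simp add: R_def)
  define S where "S N = (\<Sum>k<N. r k * R k)" for N
  have S_nn: "0 \<le> S N" for N using r R_pos by (simp add: S_def sum_nonneg less_imp_le)
  have R0: "R 0 \<le> y" by (use q in \<open>auto simp: R_def y_def intro: powr_mono2\<close>)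
  have ind: "(\<Sum>k<Suc N. link_radius D r k * R k) \<le> D * y + 2 * y * S N + 2 * S (Suc N)" for N
  proof (induction N)
    case 0
    have "D * R 0 \<le> D * y" using R0 D by (intro mult_left_mono) auto
    then show ?case using S_nn[of 1] by (simp add: link_radius_def S_def[of 0])
  next
    case (Suc N)
    then show ?case by (simp add: link_radius_def S_def R_Suc algebra_simps)
  qed
  have "(\<Sum>k<N. link_radius D r k * R k) \<le> (\<Sum>k<Suc N. link_radius D r k * R k)"
    using r[of 0] r R_pos D by (auto simp: link_radius_def add_pos_pos less_imp_le split: nat.split)
  also have "\<dots> \<le> D * y + 2 * y * S N + 2 * S (Suc N)" by (rule ind)
  also have "\<dots> \<le> D * y + 2 * (y + 1) * S (Suc N)"
  proof -
    have "S N \<le> S (Suc N)" using r[of N] R_pos[of N] by (simp add: S_def)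
    then have "y * S N \<le> y * S (Suc N)" using y by (intro mult_left_mono) auto
    then show ?thesis by (simp add: algebra_simps)
  qed
  also have "\<dots> \<le> 2 * (y + 1) / (1 - 1 / y) * J"
  proof -
    have w: "0 < 1 - 1 / y" using y by simp
    have "D * y * (1 - 1 / y) \<le> 2 * (y + 1) * D"
      using y D by (simp add: field_simps)
    then have "(D * y + 2 * (y + 1) * S (Suc N)) * (1 - 1 / y) \<le> 2 * (y + 1) * ((1 - 1 / y) * S (Suc N) + D)"
      by (simp add: algebra_simps)
    also have "\<dots> \<le> 2 * (y + 1) * J"
      using J[of "Suc N"] y unfolding S_def R_def y_def by (intro mult_left_mono) auto
    finally show ?thesis using w by (simp add: pos_le_divide_eq)
  qed
  finally have *: "(\<Sum>k<N. link_radius D r k * R k) \<le> 2 * (y + 1) / (1 - 1 / y) * J" .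
  have "(5.2 * 4 ^ k :: real) powr q = 2.6 powr q * R k" for k
    by (simp add: R_def flip: powr_mult)
  then have "(\<Sum>k<N. link_radius D r k * (5.2 * 4 ^ k) powr q) = 2.6 powr q * (\<Sum>k<N. link_radius D r k * R k)"
    by (simp add: sum_distrib_left sum_distrib_right mult_ac)
  also have "\<dots> \<le> 2.6 powr q * (2 * (y + 1) / (1 - 1 / y) * J)"
    using * by (intro mult_left_mono) auto
  finally show ?thesis by (simp add: y_def)
qed

text \<open>
The weights grow like \<open>4 powr (q k)\<close> while the weighted sums stay bounded.
\<close>

lemma entropy_radii_tendsto_0:
  fixes q D J :: real
  assumes q: "0 < q" and D: "0 < D" and r: "\<And>k. 0 < r k"
    and J: "\<And>N. (1 - 1 / 4 powr q) * (\<Sum>k<N. r k * (2 * 4 ^ k) powr q) + D \<le> J"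
  shows "r \<longlonglongrightarrow> 0"
proof -
  define y where "y = 4 powr q"
  have y: "1 < y" using q by (simp add: y_def gr_one_powr)
  have le: "r k \<le> J / (1 - 1 / y) * (1 / y) ^ k" for k
  proof -
    have "y ^ k = (4 ^ k) powr q" by (simp add: y_def powr_power powr_powr mult.commute flip: powr_realpow)
    also have "\<dots> \<le> (2 * 4 ^ k) powr q" using q by (intro powr_mono2) auto
    finally have "r k * y ^ k \<le> r k * (2 * 4 ^ k) powr q" using r[of k] by (intro mult_left_mono) auto
    also have "\<dots> \<le> (\<Sum>k<Suc k. r k * (2 * 4 ^ k) powr q)"
      using r by (simp add: sum_nonneg less_imp_le)
    finally have "(1 - 1 / y) * (r k * y ^ k) \<le> (1 - 1 / y) * (\<Sum>k<Suc k. r k * (2 * 4 ^ k) powr q)"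
      using y by (intro mult_left_mono) auto
    also have "\<dots> \<le> J" using J[of "Suc k"] D by (simp add: y_def)
    finally have "r k * y ^ k \<le> J / (1 - 1 / y)" using y by (simp add: pos_le_divide_eq mult.commute)
    then have "r k \<le> J / (1 - 1 / y) / y ^ k" using y by (subst pos_le_divide_eq) auto
    then show ?thesis by (simp add: power_divide)
  qed
  have "(\<lambda>k. J / (1 - 1 / y) * (1 / y) ^ k) \<longlonglongrightarrow> J / (1 - 1 / y) * 0"
    using y by (intro tendsto_intros LIMSEQ_power_zero) auto
  then show ?thesis
    using le r by (intro tendsto_sandwich[OF _ _ tendsto_const, of 0 r]) (auto simp: less_imp_le)
qed

section \<open>Chaining with two distances at once\<close>

text \<open>
The generic chaining bound: \<open>d2\<close> controls the links pointwise through the envelope \<open>G\<close> and drives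
the convergence of the chain, while \<open>d1\<close> is only passed on to the maximal inequality for each
level, the assumption \<open>link\<close>.
\<close>

lemma outer_expectation_two_distances:
  fixes \<F> :: "('a \<Rightarrow> real) set" and G :: "'a \<Rightarrow> real"
  assumes P: "prob_space P" and M: "prob_space M" and iid: "iid_sample M P n X"
    and n: "n \<ge> 1" and G: "integrable P G" and ne: "\<F> \<noteq> {}"
    and meas: "\<And>f. f \<in> \<F> \<Longrightarrow> f \<in> borel_measurable P"
    and env: "\<And>f x. f \<in> \<F> \<Longrightarrow> x \<in> space P \<Longrightarrow> \<bar>f x\<bar> \<le> \<beta> * G x"
    and dist: "radii_add \<F> d1" "radii_add \<F> d2"
    and d2: "\<And>f g r x. f \<in> \<F> \<Longrightarrow> g \<in> \<F> \<Longrightarrow> 0 \<le> r \<Longrightarrow> d2 f g \<le> ennreal r \<Longrightarrow> x \<in> space P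
      \<Longrightarrow> \<bar>f x - g x\<bar> \<le> r * G x"
    and a: "\<And>k. 0 < a k" and b: "\<And>k. 0 < b k" "b \<longlonglongrightarrow> 0"
    and C: "\<And>k. finite (C k)" "\<And>k. is_covering (a k) \<F> d1 (C k)"
      "\<And>k. ln (real (card (C k))) \<le> 2 * 4 ^ k"
    and D: "\<And>k. finite (D k)" "\<And>k. is_covering (b k) \<F> d2 (D k)"
      "\<And>k. ln (real (card (D k))) \<le> 2 * 4 ^ k"
    and B: "\<And>k. 0 \<le> B k" "\<And>N. (\<Sum>k<N. B k) \<le> T"
    and link: "\<And>k H. finite H \<Longrightarrow> H \<noteq> {} \<Longrightarrow> ln (2 * real (card H)) \<le> 5.2 * 4 ^ k
      \<Longrightarrow> (\<And>h. h \<in> H \<Longrightarrow> h \<in> borel_measurable P)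
      \<Longrightarrow> (\<And>h x. h \<in> H \<Longrightarrow> x \<in> space P \<Longrightarrow> \<bar>h x\<bar> \<le> link_radius \<beta> b k * G x)
      \<Longrightarrow> (k = 0 \<Longrightarrow> H \<subseteq> \<F>)
      \<Longrightarrow> (\<And>h j. k = Suc j \<Longrightarrow> h \<in> H \<Longrightarrow>
            \<exists>f\<in>\<F>. \<exists>g\<in>\<F>. h = (\<lambda>x. f x - g x) \<and> d1 f g \<le> ennreal (link_radius \<alpha> a k))
      \<Longrightarrow> (\<integral>\<^sup>+\<omega>. (SUP h\<in>H. ennreal (deviation P n (\<lambda>i. X i \<omega>) h)) \<partial>M) \<le> ennreal (B k)"
  shows "outer_expectation M (\<lambda>\<omega>. sup_deviation (empirical_measure P n (\<lambda>i. X i \<omega>)) P \<F>) \<le> ennreal T"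
proof -
  have "\<exists>p. (\<forall>f\<in>\<F>. p f \<in> \<F> \<and> d1 f (p f) \<le> ennreal (a k + a k) \<and> d2 f (p f) \<le> ennreal (b k + b k))
      \<and> finite (p ` \<F>) \<and> card (p ` \<F>) \<le> card (C k) * card (D k)" for k
    by (rule common_cell_representatives[OF dist C(1,2) D(1,2) a b(1), of k]) blast
  then obtain \<pi> where \<pi>: "f \<in> \<F> \<Longrightarrow> \<pi> k f \<in> \<F>" "f \<in> \<F> \<Longrightarrow> d1 f (\<pi> k f) \<le> ennreal (a k + a k)"
      "f \<in> \<F> \<Longrightarrow> d2 f (\<pi> k f) \<le> ennreal (b k + b k)" "finite (\<pi> k ` \<F>)"
      "card (\<pi> k ` \<F>) \<le> card (C k) * card (D k)" for k f
    by metis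
  have ln_card: "ln (real (card (\<pi> k ` \<F>))) \<le> 4 * 4 ^ k" for k
  proof -
    have "0 < card (\<pi> k ` \<F>)" using ne \<pi>(4) by (simp add: card_gt_0_iff)
    moreover from this have "0 < card (C k)" "0 < card (D k)"
      using \<pi>(5)[of k] by (auto intro: Nat.gr0I)
    ultimately have "ln (real (card (\<pi> k ` \<F>))) \<le> ln (real (card (C k)) * real (card (D k)))"
      using \<pi>(5)[of k] by (subst ln_le_cancel_iff) (auto simp flip: of_nat_mult)
    also have "\<dots> = ln (real (card (C k))) + ln (real (card (D k)))"
      using \<open>0 < card (C k)\<close> \<open>0 < card (D k)\<close> by (simp add: ln_mult)
    finally show ?thesis using C(3)[of k] D(3)[of k] by linarith
  qed
  note card_link = ln_card_chain_link_le[of \<pi> \<F>, OF \<pi>(4) ne ln_card]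
  have Gnn: "0 \<le> G x" if x: "x \<in> space P" for x
  proof -
    obtain f where f: "f \<in> \<F>" using ne by blast
    have "\<bar>f x - \<pi> 0 f x\<bar> \<le> (b 0 + b 0) * G x"
      using \<pi>(1-3)[OF f] f b(1)[of 0] x by (intro d2) auto
    then have "0 \<le> (b 0 + b 0) * G x" by linarith
    then show ?thesis using b(1)[of 0] by (simp add: zero_le_mult_iff)
  qed
  have step1: "d1 (\<pi> (Suc j) f) (\<pi> j f) \<le> ennreal (link_radius \<alpha> a (Suc j))"
    and step2: "d2 (\<pi> (Suc j) f) (\<pi> j f) \<le> ennreal (link_radius \<beta> b (Suc j))" if f: "f \<in> \<F>" for j f
  proof -
    have sym: "d1 (\<pi> k f) f = d1 f (\<pi> k f)" "d2 (\<pi> k f) f = d2 f (\<pi> k f)" for k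
      using dist \<pi>(1)[OF f] f by (auto simp: radii_add_def)
    have 1: "d1 (\<pi> (Suc j) f) (\<pi> j f) \<le> ennreal ((a (Suc j) + a (Suc j)) + (a j + a j))"
      by (rule radii_addD[OF dist(1) \<pi>(1)[OF f] f \<pi>(1)[OF f]])
        (simp_all only: sym \<pi>(2)[OF f] add_pos_pos a)
    have 2: "d2 (\<pi> (Suc j) f) (\<pi> j f) \<le> ennreal ((b (Suc j) + b (Suc j)) + (b j + b j))"
      by (rule radii_addD[OF dist(2) \<pi>(1)[OF f] f \<pi>(1)[OF f]])
        (simp_all only: sym \<pi>(3)[OF f] add_pos_pos b(1))
    have eq: "r + r + (s + s) = 2 * (s + r)" for r s :: real by simp
    show "d1 (\<pi> (Suc j) f) (\<pi> j f) \<le> ennreal (link_radius \<alpha> a (Suc j))"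
      "d2 (\<pi> (Suc j) f) (\<pi> j f) \<le> ennreal (link_radius \<beta> b (Suc j))"
      using 1 2 unfolding eq by (simp_all only: link_radius_def nat.case)
  qed
  have "outer_expectation M (\<lambda>\<omega>. sup_deviation (empirical_measure P n (\<lambda>i. X i \<omega>)) P \<F>)
    \<le> (\<Sum>k. \<integral>\<^sup>+\<omega>. (SUP h\<in>chain_link \<pi> k ` \<F>. ennreal (deviation P n (\<lambda>i. X i \<omega>) h)) \<partial>M)"
  proof (rule outer_expectation_chaining[OF P M iid n G, where b = \<beta> and \<delta> = "\<lambda>k. b k + b k"])
    show "\<bar>f x - \<pi> k f x\<bar> \<le> (b k + b k) * G x" if "f \<in> \<F>" "x \<in> space P" for k f x
      using \<pi>(1-3)[OF that(1)] that b(1)[of k] by (intro d2) auto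
    show "(\<lambda>k. b k + b k) \<longlonglongrightarrow> 0" using tendsto_add[OF b(2) b(2)] by simp
  qed (fact meas env \<pi>(1) card_link(1))+
  also have "\<dots> \<le> (\<Sum>k. ennreal (B k))"
  proof (intro suminf_le allI summableI)
    fix k
    show "(\<integral>\<^sup>+\<omega>. (SUP h\<in>chain_link \<pi> k ` \<F>. ennreal (deviation P n (\<lambda>i. X i \<omega>) h)) \<partial>M) \<le> ennreal (B k)"
    proof (rule link)
      show "h \<in> borel_measurable P" if "h \<in> chain_link \<pi> k ` \<F>" for h
        using that meas \<pi>(1) by (cases k) (auto simp: chain_link_def)
      show "\<bar>h x\<bar> \<le> link_radius \<beta> b k * G x" if h: "h \<in> chain_link \<pi> k ` \<F>" and x: "x \<in> space P" for h x
      proof (cases k)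
        case 0
        then show ?thesis using h env[OF \<pi>(1) x] by (auto simp: chain_link_def link_radius_def)
      next
        case (Suc j)
        then obtain f where f: "f \<in> \<F>" "h = (\<lambda>x. \<pi> (Suc j) f x - \<pi> j f x)"
          using h by (auto simp: chain_link_def)
        have "0 \<le> link_radius \<beta> b (Suc j)" using b(1)[of j] b(1)[of "Suc j"] by (simp add: link_radius_def)
        then show ?thesis unfolding f(2) Suc using \<pi>(1)[OF f(1)] step2[OF f(1)] x by (intro d2) auto
      qed
      show "chain_link \<pi> k ` \<F> \<subseteq> \<F>" if "k = 0"
        using \<pi>(1) that by (auto simp: chain_link_def)
      show "\<exists>f\<in>\<F>. \<exists>g\<in>\<F>. h = (\<lambda>x. f x - g x) \<and> d1 f g \<le> ennreal (link_radius \<alpha> a k)"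
        if j: "k = Suc j" and h: "h \<in> chain_link \<pi> k ` \<F>" for h j
      proof -
        obtain f where f: "f \<in> \<F>" "h = (\<lambda>x. \<pi> (Suc j) f x - \<pi> j f x)"
          using h j by (auto simp: chain_link_def)
        show ?thesis unfolding j
          using f(2) step1[OF f(1)] by (intro bexI[OF _ \<pi>(1)[OF f(1)]]) (rule conjI)
      qed
    qed (use card_link ne in auto)
  qed
  also have "\<dots> \<le> ennreal T"
  proof (rule suminf_le_const)
    show "(\<Sum>k<N. ennreal (B k)) \<le> ennreal T" for N
      using B by (simp add: sum_ennreal ennreal_leI)
  qed (rule summableI)
  finally show ?thesis .
qed

section \<open>The two norms of the theorem\<close>

lemma Lp_norm_le_iff:
  assumes p: "0 < p" and r: "0 \<le> r"
  shows "Lp_norm P p f \<le> ennreal r \<longleftrightarrow> (\<integral>\<^sup>+x. ennreal (\<bar>f x\<bar> powr p) \<partial>P) \<le> ennreal (r powr p)"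
proof (cases "\<integral>\<^sup>+x. ennreal (\<bar>f x\<bar> powr p) \<partial>P")
  case (real i)
  have "i powr (1 / p) \<le> r \<longleftrightarrow> i \<le> r powr p"
  proof
    assume "i powr (1 / p) \<le> r"
    then have "(i powr (1 / p)) powr p \<le> r powr p" using p by (intro powr_mono2) auto
    then show "i \<le> r powr p" using p real by (simp add: powr_powr)
  next
    assume "i \<le> r powr p"
    then have "i powr (1 / p) \<le> (r powr p) powr (1 / p)" using p real by (intro powr_mono2) auto
    then show "i powr (1 / p) \<le> r" using p r by (simp add: powr_powr)
  qed
  then show ?thesis using real p r by (simp add: Lp_norm_def epowr_def)
next
  case top
  then show ?thesis using p by (simp add: Lp_norm_def epowr_def top_unique)
qed

lemma L2_norm_le_iff:
  assumes "0 \<le> r"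
  shows "Lp_norm P 2 f \<le> ennreal r \<longleftrightarrow> (\<integral>\<^sup>+x. ennreal ((f x)\<^sup>2) \<partial>P) \<le> ennreal (r\<^sup>2)"
  using Lp_norm_le_iff[of 2 r P f] assms by simp

text \<open>
Minkowski's inequality, from \<open>(u + v)\<^sup>2 \<le> (1 + s/r) u\<^sup>2 + (1 + r/s) v\<^sup>2\<close>: these weights make the
integrated bound equal to \<open>(r + s)\<^sup>2\<close>.
\<close>

lemma L2_norm_add_le:
  assumes [measurable]: "f \<in> borel_measurable P" "g \<in> borel_measurable P"
    and pos: "0 < r" "0 < s" and f: "Lp_norm P 2 f \<le> ennreal r" and g: "Lp_norm P 2 g \<le> ennreal s"
  shows "Lp_norm P 2 (\<lambda>x. f x + g x) \<le> ennreal (r + s)"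
proof -
  have pointwise: "(u + v)\<^sup>2 \<le> (1 + s / r) * u\<^sup>2 + (1 + r / s) * v\<^sup>2" for u v :: real
  proof -
    have "(1 + s / r) * u\<^sup>2 + (1 + r / s) * v\<^sup>2 - (u + v)\<^sup>2 = (s * u - r * v)\<^sup>2 / (r * s)"
      using pos by (simp add: field_simps power2_eq_square)
    moreover have "0 \<le> (s * u - r * v)\<^sup>2 / (r * s)" using pos by simp
    ultimately show ?thesis by linarith
  qed
  have "(\<integral>\<^sup>+x. ennreal ((f x + g x)\<^sup>2) \<partial>P)
    \<le> (\<integral>\<^sup>+x. ennreal (1 + s / r) * ennreal ((f x)\<^sup>2) + ennreal (1 + r / s) * ennreal ((g x)\<^sup>2) \<partial>P)"
    using pos pointwise
    by (intro nn_integral_mono) (simp add: ennreal_mult[symmetric] ennreal_plus[symmetric] ennreal_leI del: ennreal_plus)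
  also have "\<dots> = ennreal (1 + s / r) * (\<integral>\<^sup>+x. ennreal ((f x)\<^sup>2) \<partial>P)
      + ennreal (1 + r / s) * (\<integral>\<^sup>+x. ennreal ((g x)\<^sup>2) \<partial>P)"
    by (simp add: nn_integral_add nn_integral_cmult del: ennreal_plus)
  also have "\<dots> \<le> ennreal (1 + s / r) * ennreal (r\<^sup>2) + ennreal (1 + r / s) * ennreal (s\<^sup>2)"
    using f g pos by (intro add_mono mult_left_mono) (auto simp: L2_norm_le_iff)
  also have "\<dots> = ennreal ((1 + s / r) * r\<^sup>2 + (1 + r / s) * s\<^sup>2)"
    using pos by (simp add: ennreal_mult[symmetric] ennreal_plus[symmetric] del: ennreal_plus)
  also have "(1 + s / r) * r\<^sup>2 + (1 + r / s) * s\<^sup>2 = (r + s)\<^sup>2"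
    using pos by (simp add: field_simps power2_eq_square)
  finally show ?thesis using pos by (simp add: L2_norm_le_iff del: ennreal_plus)
qed

lemma Lp_norm_uminus: "Lp_norm P p (\<lambda>x. - f x) = Lp_norm P p f"
  by (simp add: Lp_norm_def)

lemma radii_add_L2:
  assumes "\<And>f. f \<in> K \<Longrightarrow> f \<in> borel_measurable P"
  shows "radii_add K (norm_dist (Lp_norm P 2))"
  unfolding radii_add_def norm_dist_def
proof (intro conjI ballI allI impI)
  show "Lp_norm P 2 (\<lambda>x. f x - g x) = Lp_norm P 2 (\<lambda>x. g x - f x)" for f g
    using Lp_norm_uminus[of P 2 "\<lambda>x. f x - g x"] by simp
  show "Lp_norm P 2 (\<lambda>x. f x - h x) \<le> ennreal (r + s)"
    if "f \<in> K" "g \<in> K" "h \<in> K" "0 < r" "0 < s" "Lp_norm P 2 (\<lambda>x. f x - g x) \<le> ennreal r"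
      "Lp_norm P 2 (\<lambda>x. g x - h x) \<le> ennreal s" for f g h r s
    using L2_norm_add_le[of "\<lambda>x. f x - g x" P "\<lambda>x. g x - h x" r s] that assms by simp
qed

lemma weighted_sup_norm_le_iff:
  assumes "0 \<le> r"
  shows "weighted_sup_norm S w f \<le> ennreal r \<longleftrightarrow> (\<forall>x\<in>S. \<bar>f x\<bar> * w x \<le> r)"
  using assms by (simp add: weighted_sup_norm_def SUP_le_iff)

lemma radii_add_weighted_sup:
  assumes "\<And>x. x \<in> S \<Longrightarrow> 0 < w x"
  shows "radii_add K (norm_dist (weighted_sup_norm S w))"
  unfolding radii_add_def norm_dist_def
proof (intro conjI ballI allI impI)
  show "weighted_sup_norm S w (\<lambda>x. f x - g x) = weighted_sup_norm S w (\<lambda>x. g x - f x)" for f g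
    by (simp add: weighted_sup_norm_def abs_minus_commute)
  fix f g h r s
  assume *: "0 < r" "0 < s" "weighted_sup_norm S w (\<lambda>x. f x - g x) \<le> ennreal r"
    "weighted_sup_norm S w (\<lambda>x. g x - h x) \<le> ennreal s"
  show "weighted_sup_norm S w (\<lambda>x. f x - h x) \<le> ennreal (r + s)"
    unfolding weighted_sup_norm_le_iff[OF add_nonneg_nonneg[OF less_imp_le[OF *(1)] less_imp_le[OF *(2)]]]
  proof
    fix x assume x: "x \<in> S"
    have "\<bar>f x - h x\<bar> * w x \<le> (\<bar>f x - g x\<bar> + \<bar>g x - h x\<bar>) * w x"
      using assms[OF x] by (intro mult_right_mono) auto
    moreover have "\<bar>f x - g x\<bar> * w x \<le> r" "\<bar>g x - h x\<bar> * w x \<le> s"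
      using * x by (simp_all add: weighted_sup_norm_le_iff)
    ultimately show "\<bar>f x - h x\<bar> * w x \<le> r + s" by (simp add: distrib_right)
  qed
qed

lemma weighted_sup_norm_leD:
  assumes "weighted_sup_norm S w f \<le> ennreal b" "0 \<le> b" "x \<in> S" "0 < w x"
  shows "\<bar>f x\<bar> \<le> b * (1 / w x)"
proof -
  have "\<bar>f x\<bar> * w x \<le> b" using assms by (simp add: weighted_sup_norm_le_iff)
  then show ?thesis using assms(4) by (simp add: pos_le_divide_eq)
qed

lemma weighted_sup_norm_diff_le:
  assumes "weighted_sup_norm S w f \<le> ennreal b" "weighted_sup_norm S w f' \<le> ennreal b" "0 \<le> b"
    and w: "\<And>x. x \<in> S \<Longrightarrow> 0 < w x"
  shows "norm_dist (weighted_sup_norm S w) f f' \<le> ennreal (2 * b)"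
proof -
  have "\<bar>f x - f' x\<bar> * w x \<le> 2 * b" if x: "x \<in> S" for x
  proof -
    have "\<bar>f x - f' x\<bar> \<le> 2 * b * (1 / w x)"
      using weighted_sup_norm_leD[OF assms(1,3) x w[OF x]] weighted_sup_norm_leD[OF assms(2,3) x w[OF x]]
      by linarith
    then show ?thesis using w[OF x] by (simp add: pos_le_divide_eq)
  qed
  then show ?thesis unfolding norm_dist_def using assms(3) by (subst weighted_sup_norm_le_iff) auto
qed

section \<open>Numerical constants and the two regimes of the moment exponent\<close>

lemma truncated_second_moment_le:
  assumes "0 \<le> V" and "Lp_norm P 2 h \<le> ennreal V"
  shows "(\<integral>x. (if A x then (h x)\<^sup>2 else 0) \<partial>P) \<le> V\<^sup>2"
proof (rule integral_real_bounded)
  have "(\<integral>\<^sup>+x. ennreal (if A x then (h x)\<^sup>2 else 0) \<partial>P) \<le> (\<integral>\<^sup>+x. ennreal ((h x)\<^sup>2) \<partial>P)"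
    by (intro nn_integral_mono) auto
  also have "\<dots> \<le> ennreal (V\<^sup>2)" using assms by (simp add: L2_norm_le_iff)
  finally show "(\<integral>\<^sup>+x. ennreal (if A x then (h x)\<^sup>2 else 0) \<partial>P) \<le> ennreal (V\<^sup>2)" .
qed simp

text \<open>
With \<open>y = 4 powr q\<close> in \<open>[2, 4]\<close>, the factor \<open>2 (y + 1) y / (y - 1)\<close> is at most \<open>40/3\<close>, attained at
\<open>y = 4\<close>; the resulting constant is 104.
\<close>

lemma chaining_constant_ge_half:
  fixes q :: real
  assumes "1 / 2 \<le> q" "q \<le> 1"
  shows "3 * (2.6 powr q * (2 * (4 powr q + 1) / (1 - 1 / 4 powr q))) \<le> 104.37"
proof -
  define y where "y = 4 powr q"
  have "4 powr (1 / 2) \<le> y" unfolding y_def using assms by (intro powr_mono) auto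
  then have y2: "2 \<le> y" by (simp add: powr_half_sqrt)
  have "y \<le> 4 powr 1" unfolding y_def using assms by (intro powr_mono) auto
  then have y4: "y \<le> 4" by simp
  have "0 \<le> (3 * y - 5) * (4 - y)" using y2 y4 by (intro mult_nonneg_nonneg) auto
  then have "2 * (y + 1) * y \<le> 40 / 3 * (y - 1)" by (simp add: algebra_simps)
  then have 1: "2 * (y + 1) / (1 - 1 / y) \<le> 40 / 3" using y2 by (simp add: field_simps)
  have "(2.6::real) powr q \<le> 2.6 powr 1" using assms by (intro powr_mono) auto
  then have "2.6 powr q * (2 * (y + 1) / (1 - 1 / y)) \<le> 2.6 * (40 / 3)"
    using 1 y2 by (intro mult_mono) auto
  then have "3 * (2.6 powr q * (2 * (y + 1) / (1 - 1 / y))) \<le> 3 * (2.6 * (40 / 3))"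
    by (intro mult_left_mono) auto
  also have "\<dots> \<le> 104.37" by simp
  finally show ?thesis by (simp add: y_def)
qed

lemma chaining_constant_half:
  "2 * (2.6 powr (1 / 2) * (2 * (4 powr (1 / 2) + 1) / (1 - 1 / 4 powr (1 / 2)))) \<le> (127.63 :: real)"
proof -
  have "sqrt 2.6 \<le> (2::real)" by (rule real_le_lsqrt) auto
  then show ?thesis by (simp add: powr_half_sqrt)
qed

text \<open>
The factor \<open>1/\<kappa>\<close> arises here: the weighted arithmetic-geometric mean inequality gives
\<open>1 - 4 powr (-q) \<ge> q \<ge> \<kappa>/2\<close>, so the geometric series of the chain sums to at most \<open>2/\<kappa>\<close>.
\<close>

lemma chaining_constant_le_half:
  fixes \<kappa> :: real
  assumes \<kappa>: "0 < \<kappa>" "\<kappa> \<le> 1" and q: "q = 1 - 1 / (1 + \<kappa>)"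
  shows "5 * (2.6 powr q * (2 * (4 powr q + 1) / (1 - 1 / 4 powr q))) \<le> 104.37 / \<kappa>"
proof -
  have q_eq: "q = \<kappa> / (1 + \<kappa>)" using \<kappa> q by (simp add: field_simps)
  have q_ge: "\<kappa> / 2 \<le> q" unfolding q_eq using \<kappa> by (intro divide_left_mono) auto
  have q_le: "q \<le> 1 / 2" using \<kappa> by (simp add: q_eq field_simps)
  have q_pos: "0 < q" using q_ge \<kappa> by linarith
  have "(1 / 2) powr (2 * q) * 1 powr (1 - 2 * q) \<le> 2 * q * (1 / 2) + (1 - 2 * q) * 1"
    using q_pos q_le by (intro Youngs_inequality_0) auto
  moreover have "(1 / 2) powr (2 * q) = 1 / 4 powr q"
  proof -
    have "(1 / 2 :: real) powr (2 * q) = ((1 / 2) powr 2) powr q" by (simp only: powr_powr)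
    also have "\<dots> = (1 / 4) powr q" by (simp add: power_divide)
    finally show ?thesis by (simp add: powr_divide powr_mult mult_ac)
  qed
  ultimately have lower: "\<kappa> / 2 \<le> 1 - 1 / 4 powr q" using q_ge by simp
  have "4 powr q \<le> (4::real) powr (1 / 2)" using q_le by (intro powr_mono) auto
  then have y: "4 powr q \<le> (2::real)" by (simp add: powr_half_sqrt)
  have "(2.6::real) powr q \<le> 2.6 powr (1 / 2)" using q_le by (intro powr_mono) auto
  also have "\<dots> = sqrt 2.6" by (simp add: powr_half_sqrt)
  also have "\<dots> \<le> 13 / 8" by (rule real_le_lsqrt) (auto simp: power2_eq_square)
  finally have factor: "(2.6::real) powr q \<le> 13 / 8" .
  have "0 \<le> 2 * (4 powr q + 1) / (1 - 1 / 4 powr q)"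
    using gr_one_powr[of 4 q] q_pos by (intro divide_nonneg_pos) auto
  moreover have "2 * (4 powr q + 1) / (1 - 1 / 4 powr q) \<le> 6 / (\<kappa> / 2)"
    using lower y \<kappa> by (intro frac_le) auto
  ultimately have "2.6 powr q * (2 * (4 powr q + 1) / (1 - 1 / 4 powr q)) \<le> 13 / 8 * (6 / (\<kappa> / 2))"
    using factor by (intro mult_mono) auto
  then have "5 * (2.6 powr q * (2 * (4 powr q + 1) / (1 - 1 / 4 powr q))) \<le> 5 * (13 / 8 * (6 / (\<kappa> / 2)))"
    by (intro mult_left_mono) auto
  also have "\<dots> = 97.5 / \<kappa>" by simp
  also have "\<dots> \<le> 104.37 / \<kappa>" using \<kappa> by (intro divide_right_mono) auto
  finally show ?thesis .
qed

text \<open>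
The regime \<open>m \<ge> 2\<close>: the second moments of the links are controlled by their \<open>L\<^sup>2\<close> norms, so the
coverings in the two norms run in parallel and the two entropy integrals add up.
\<close>

lemma outer_expectation_sup_deviation_square_integrable:
  fixes \<F> :: "('a \<Rightarrow> real) set" and w :: "'a \<Rightarrow> real"
  assumes P: "prob_space P" and M: "prob_space M" and iid: "iid_sample M P n X"
    and n: "n \<ge> 1" and ne: "\<F> \<noteq> {}" and m: "m \<ge> 2" and \<sigma>: "0 < \<sigma>" and b0: "0 < b0" and g: "0 < g"
    and meas: "\<And>f. f \<in> \<F> \<Longrightarrow> f \<in> borel_measurable P"
    and L2: "\<And>f. f \<in> \<F> \<Longrightarrow> Lp_norm P 2 f \<le> ennreal \<sigma>"
    and w: "\<And>x. x \<in> space P \<Longrightarrow> 0 < w x"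
    and env: "\<And>f. f \<in> \<F> \<Longrightarrow> weighted_sup_norm (space P) w f \<le> ennreal b0"
    and G: "integrable P (\<lambda>x. 1 / w x)"
    and Gm: "integrable P (\<lambda>x. (1 / w x) powr m)" "(\<integral>x. (1 / w x) powr m \<partial>P) \<le> g powr m"
    and J2: "0 \<le> J2" "entropy_integral \<F> (norm_dist (Lp_norm P 2)) (1 / 2) (ennreal (2 * \<sigma>)) \<le> ennreal J2"
    and Jw: "0 \<le> Jw" "entropy_integral \<F> (norm_dist (weighted_sup_norm (space P) w)) (1 - 1 / m)
      (ennreal (2 * b0)) \<le> ennreal Jw"
  shows "outer_expectation M (\<lambda>\<omega>. sup_deviation (empirical_measure P n (\<lambda>i. X i \<omega>)) P \<F>)
    \<le> ennreal (127.63 / real n powr (1 / 2) * J2 + 104.37 * (g / real n powr (1 - 1 / m)) * Jw)"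
proof -
  let ?d1 = "norm_dist (Lp_norm P 2)" and ?d2 = "norm_dist (weighted_sup_norm (space P) w)"
  define q where "q = 1 - 1 / m"
  have q: "1 / 2 \<le> q" "q \<le> 1" using m by (simp_all add: q_def field_simps)
  have dist: "radii_add \<F> ?d1" "radii_add \<F> ?d2"
    using meas w by (blast intro: radii_add_L2 radii_add_weighted_sup)+
  have diam1: "?d1 f f' \<le> ennreal (2 * \<sigma>)" if "f \<in> \<F>" "f' \<in> \<F>" for f f'
  proof -
    have "Lp_norm P 2 (\<lambda>x. f x + - f' x) \<le> ennreal (\<sigma> + \<sigma>)"
      using that meas L2 \<sigma> by (intro L2_norm_add_le) (auto simp: Lp_norm_uminus)
    then show ?thesis by (simp add: norm_dist_def)
  qed
  have env': "\<bar>f x\<bar> \<le> b0 * (1 / w x)" if "f \<in> \<F>" "x \<in> space P" for f x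
    using weighted_sup_norm_leD[OF env[OF that(1)] _ that(2) w[OF that(2)]] b0 by simp
  have diam2: "?d2 f f' \<le> ennreal (2 * b0)" if "f \<in> \<F>" "f' \<in> \<F>" for f f'
    using that env b0 w by (intro weighted_sup_norm_diff_le) auto
  obtain a C where a: "\<And>k. 0 < a k" and C: "\<And>k. finite (C k)" "\<And>k. is_covering (a k) \<F> ?d1 (C k)"
    "\<And>k. ln (real (card (C k))) \<le> 2 * 4 ^ k"
    and a_sum: "\<And>N. (1 - 1 / 4 powr (1 / 2)) * (\<Sum>k<N. a k * (2 * 4 ^ k) powr (1 / 2)) + \<sigma> \<le> J2"
    by (rule entropy_radii[OF _ \<sigma> _ ne diam1 J2, where L = 2]) auto
  obtain b D where b: "\<And>k. 0 < b k" and D: "\<And>k. finite (D k)" "\<And>k. is_covering (b k) \<F> ?d2 (D k)"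
    "\<And>k. ln (real (card (D k))) \<le> 2 * 4 ^ k"
    and b_sum: "\<And>N. (1 - 1 / 4 powr q) * (\<Sum>k<N. b k * (2 * 4 ^ k) powr q) + b0 \<le> Jw"
    by (rule entropy_radii[OF _ b0 _ ne diam2 Jw[folded q_def], where L = 2]) (use q in auto)
  define \<Lambda> where "\<Lambda> k = 5.2 * 4 ^ k / real n" for k :: nat
  define B where "B k = 2 * link_radius \<sigma> a k * sqrt (\<Lambda> k) + 3 * link_radius b0 b k * g * \<Lambda> k powr q" for k
  define c1 where "c1 = 2.6 powr (1 / 2) * (2 * (4 powr (1 / 2) + 1) / (1 - 1 / 4 powr (1 / 2 :: real)))"
  define cw where "cw = 2.6 powr q * (2 * (4 powr q + 1) / (1 - 1 / 4 powr q))"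
  have \<Lambda>: "0 < \<Lambda> k" for k using n by (simp add: \<Lambda>_def)
  have \<alpha>_pos: "0 < link_radius \<sigma> a k" for k
    using \<sigma> a by (auto simp: link_radius_def add_pos_pos split: nat.split)
  have \<beta>_pos: "0 < link_radius b0 b k" for k
    using b0 b by (auto simp: link_radius_def add_pos_pos split: nat.split)
  have B_sum: "(\<Sum>k<N. B k) \<le> 127.63 / real n powr (1 / 2) * J2 + 104.37 * (g / real n powr q) * Jw" for N
  proof -
    have "(\<Sum>k<N. B k) = 2 / real n powr (1 / 2) * (\<Sum>k<N. link_radius \<sigma> a k * (5.2 * 4 ^ k) powr (1 / 2))
      + 3 * (g / real n powr q) * (\<Sum>k<N. link_radius b0 b k * (5.2 * 4 ^ k) powr q)"
      unfolding B_def sum.distrib sum_distrib_left \<Lambda>_def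
      by (intro arg_cong2[where f = "(+)"] sum.cong refl)
        (simp_all add: powr_divide powr_mult real_sqrt_divide real_sqrt_mult powr_half_sqrt mult_ac)
    also have "\<dots> \<le> 2 / real n powr (1 / 2) * (c1 * J2) + 3 * (g / real n powr q) * (cw * Jw)"
      unfolding c1_def cw_def using q g
      by (intro add_mono mult_left_mono link_radius_sum_le[OF _ _ \<sigma> a a_sum] link_radius_sum_le[OF _ q(2) b0 b b_sum]) auto
    also have "\<dots> = 2 * c1 * (J2 / real n powr (1 / 2)) + 3 * cw * (g / real n powr q * Jw)"
      by (simp add: mult_ac)
    also have "\<dots> \<le> 127.63 * (J2 / real n powr (1 / 2)) + 104.37 * (g / real n powr q * Jw)"
      using chaining_constant_half chaining_constant_ge_half[OF q] J2(1) Jw(1) g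
      unfolding c1_def[symmetric] cw_def[symmetric] by (intro add_mono mult_right_mono) auto
    finally show ?thesis by simp
  qed
  show ?thesis unfolding q_def[symmetric]
  proof (rule outer_expectation_two_distances[where ?d1.0 = ?d1 and ?d2.0 = ?d2 and a = a and b = b and B = B
        and G = "\<lambda>x. 1 / w x" and \<alpha> = \<sigma> and \<beta> = b0 and C = C and D = D])
    show "b \<longlonglongrightarrow> 0" by (rule entropy_radii_tendsto_0[OF _ b0 b b_sum]) (use q in auto)
    show "\<bar>f x - f' x\<bar> \<le> r * (1 / w x)"
      if "f \<in> \<F>" "f' \<in> \<F>" "0 \<le> r" "?d2 f f' \<le> ennreal r" "x \<in> space P" for f f' r x
      using that w[OF that(5)] by (simp add: norm_dist_def weighted_sup_norm_le_iff pos_le_divide_eq)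
    show "0 \<le> B k" for k
      using \<alpha>_pos[of k] \<beta>_pos[of k] g \<Lambda>[of k] by (simp add: B_def)
    fix k H
    assume H: "finite H" "H \<noteq> {}" "ln (2 * real (card H)) \<le> 5.2 * 4 ^ k"
      and Hm: "\<And>h. h \<in> H \<Longrightarrow> h \<in> borel_measurable P"
      and He: "\<And>h x. h \<in> H \<Longrightarrow> x \<in> space P \<Longrightarrow> \<bar>h x\<bar> \<le> link_radius b0 b k * (1 / w x)"
      and H0: "k = 0 \<Longrightarrow> H \<subseteq> \<F>"
      and HS: "\<And>h j. k = Suc j \<Longrightarrow> h \<in> H \<Longrightarrow>
            \<exists>f\<in>\<F>. \<exists>f'\<in>\<F>. h = (\<lambda>x. f x - f' x) \<and> ?d1 f f' \<le> ennreal (link_radius \<sigma> a k)"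
    have norm_h: "Lp_norm P 2 h \<le> ennreal (link_radius \<sigma> a k)" if h: "h \<in> H" for h
    proof (cases k)
      case 0
      then show ?thesis using H0 h L2 by (auto simp: link_radius_def)
    next
      case (Suc j)
      then show ?thesis using HS[OF Suc h] by (auto simp: norm_dist_def)
    qed
    have "ln (2 * real (card H)) \<le> real n * \<Lambda> k" using H(3) n by (simp add: \<Lambda>_def)
    then show "(\<integral>\<^sup>+\<omega>. (SUP h\<in>H. ennreal (deviation P n (\<lambda>i. X i \<omega>) h)) \<partial>M) \<le> ennreal (B k)"
      unfolding B_def q_def
    proof (rule expected_max_deviation_moment_le[OF P M iid n H(1,2) _ \<Lambda> \<beta>_pos \<alpha>_pos _ g G])
      show "(\<integral>x. (if 1 / w x \<le> g * \<Lambda> k powr (- (1 / m)) then (h x)\<^sup>2 else 0) \<partial>P)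
        \<le> (link_radius \<sigma> a k)\<^sup>2" if "h \<in> H" for h
        using norm_h[OF that] \<alpha>_pos[of k] by (intro truncated_second_moment_le) auto
    qed (use m Gm Hm He w in \<open>auto simp: less_imp_le\<close>)
  qed (fact P M iid n G ne meas env' dist a b C D B_sum)+
qed

text \<open>
The regime \<open>m \<le> 2\<close>: only the weighted sup distance matters, so the first distance of the generic
chaining bound is taken to be zero, with single-element coverings.
\<close>

lemma outer_expectation_sup_deviation_heavy_tailed:
  fixes \<F> :: "('a \<Rightarrow> real) set" and w :: "'a \<Rightarrow> real"
  assumes P: "prob_space P" and M: "prob_space M" and iid: "iid_sample M P n X"
    and n: "n \<ge> 1" and ne: "\<F> \<noteq> {}" and \<kappa>: "0 < \<kappa>" "\<kappa> \<le> 1" and m: "m = 1 + \<kappa>"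
    and b0: "0 < b0" and g: "0 < g"
    and meas: "\<And>f. f \<in> \<F> \<Longrightarrow> f \<in> borel_measurable P"
    and w: "\<And>x. x \<in> space P \<Longrightarrow> 0 < w x"
    and env: "\<And>f. f \<in> \<F> \<Longrightarrow> weighted_sup_norm (space P) w f \<le> ennreal b0"
    and G: "integrable P (\<lambda>x. 1 / w x)"
    and Gm: "integrable P (\<lambda>x. (1 / w x) powr m)" "(\<integral>x. (1 / w x) powr m \<partial>P) \<le> g powr m"
    and Jw: "0 \<le> Jw" "entropy_integral \<F> (norm_dist (weighted_sup_norm (space P) w)) (1 - 1 / m)
      (ennreal (2 * b0)) \<le> ennreal Jw"
  shows "outer_expectation M (\<lambda>\<omega>. sup_deviation (empirical_measure P n (\<lambda>i. X i \<omega>)) P \<F>)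
    \<le> ennreal (104.37 / \<kappa> * (g / real n powr (1 - 1 / m)) * Jw)"
proof -
  let ?d2 = "norm_dist (weighted_sup_norm (space P) w)"
  define q where "q = 1 - 1 / m"
  have q: "0 < q" "q \<le> 1" using m \<kappa> by (simp_all add: q_def field_simps)
  have m_bounds: "1 < m" "m \<le> 2" using m \<kappa> by auto
  obtain f0 where f0: "f0 \<in> \<F>" using ne by blast
  define d1 :: "('a \<Rightarrow> real) \<Rightarrow> ('a \<Rightarrow> real) \<Rightarrow> ennreal" where "d1 f f' = 0" for f f'
  define a :: "nat \<Rightarrow> real" where "a k = 1" for k
  define C where "C k = {f0}" for k :: nat
  have a: "0 < a k" for k by (simp add: a_def)
  have C: "finite (C k)" "is_covering (a k) \<F> d1 (C k)" "ln (real (card (C k))) \<le> 2 * 4 ^ k" for k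
    using f0 by (auto simp: C_def is_covering_def d1_def)
  have dist: "radii_add \<F> d1" "radii_add \<F> ?d2"
    using w by (simp add: radii_add_def d1_def, blast intro: radii_add_weighted_sup)
  have env': "\<bar>f x\<bar> \<le> b0 * (1 / w x)" if "f \<in> \<F>" "x \<in> space P" for f x
    using weighted_sup_norm_leD[OF env[OF that(1)] _ that(2) w[OF that(2)]] b0 by simp
  have diam2: "?d2 f f' \<le> ennreal (2 * b0)" if "f \<in> \<F>" "f' \<in> \<F>" for f f'
    using that env b0 w by (intro weighted_sup_norm_diff_le) auto
  obtain b D where b: "\<And>k. 0 < b k" and D: "\<And>k. finite (D k)" "\<And>k. is_covering (b k) \<F> ?d2 (D k)"
    "\<And>k. ln (real (card (D k))) \<le> 2 * 4 ^ k"
    and b_sum: "\<And>N. (1 - 1 / 4 powr q) * (\<Sum>k<N. b k * (2 * 4 ^ k) powr q) + b0 \<le> Jw"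
    by (rule entropy_radii[OF q(1) b0 _ ne diam2 Jw[folded q_def], where L = 2]) auto
  define \<Lambda> where "\<Lambda> k = 5.2 * 4 ^ k / real n" for k :: nat
  define B where "B k = 5 * link_radius b0 b k * g * \<Lambda> k powr q" for k
  define cw where "cw = 2.6 powr q * (2 * (4 powr q + 1) / (1 - 1 / 4 powr q))"
  have \<Lambda>: "0 < \<Lambda> k" for k using n by (simp add: \<Lambda>_def)
  have \<beta>_pos: "0 < link_radius b0 b k" for k
    using b0 b by (auto simp: link_radius_def add_pos_pos split: nat.split)
  have B_sum: "(\<Sum>k<N. B k) \<le> 104.37 / \<kappa> * (g / real n powr q) * Jw" for N
  proof -
    have "(\<Sum>k<N. B k) = 5 * (g / real n powr q) * (\<Sum>k<N. link_radius b0 b k * (5.2 * 4 ^ k) powr q)"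
      unfolding B_def sum_distrib_left \<Lambda>_def by (intro sum.cong refl) (simp add: powr_divide powr_mult mult_ac)
    also have "\<dots> \<le> 5 * (g / real n powr q) * (cw * Jw)"
      unfolding cw_def using g by (intro mult_left_mono link_radius_sum_le[OF q b0 b b_sum]) auto
    also have "\<dots> = 5 * cw * (g / real n powr q * Jw)" by simp
    also have "\<dots> \<le> 104.37 / \<kappa> * (g / real n powr q * Jw)"
    proof (rule mult_right_mono)
      have "q = 1 - 1 / (1 + \<kappa>)" by (simp only: q_def m)
      from chaining_constant_le_half[OF \<kappa> this] show "5 * cw \<le> 104.37 / \<kappa>"
        unfolding cw_def .
      show "0 \<le> g / real n powr q * Jw" using g Jw(1) by simp
    qed
    finally show ?thesis by simp
  qed
  show ?thesis unfolding q_def[symmetric]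
  proof (rule outer_expectation_two_distances[where ?d1.0 = d1 and ?d2.0 = ?d2 and a = a and b = b and B = B
        and G = "\<lambda>x. 1 / w x" and \<alpha> = 1 and \<beta> = b0 and C = C and D = D])
    show "b \<longlonglongrightarrow> 0" by (rule entropy_radii_tendsto_0[OF q(1) b0 b b_sum])
    show "\<bar>f x - f' x\<bar> \<le> r * (1 / w x)"
      if "f \<in> \<F>" "f' \<in> \<F>" "0 \<le> r" "?d2 f f' \<le> ennreal r" "x \<in> space P" for f f' r x
      using that w[OF that(5)] by (simp add: norm_dist_def weighted_sup_norm_le_iff pos_le_divide_eq)
    show "0 \<le> B k" for k
      using \<beta>_pos[of k] g \<Lambda>[of k] by (simp add: B_def)
    fix k H
    assume H: "finite H" "H \<noteq> {}" "ln (2 * real (card H)) \<le> 5.2 * 4 ^ k"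
      and Hm: "\<And>h. h \<in> H \<Longrightarrow> h \<in> borel_measurable P"
      and He: "\<And>h x. h \<in> H \<Longrightarrow> x \<in> space P \<Longrightarrow> \<bar>h x\<bar> \<le> link_radius b0 b k * (1 / w x)"
    have "ln (2 * real (card H)) \<le> real n * \<Lambda> k" using H(3) n by (simp add: \<Lambda>_def)
    then show "(\<integral>\<^sup>+\<omega>. (SUP h\<in>H. ennreal (deviation P n (\<lambda>i. X i \<omega>) h)) \<partial>M) \<le> ennreal (B k)"
      unfolding B_def q_def
      by (rule expected_max_deviation_envelope_le[OF P M iid n H(1,2) _ \<Lambda> \<beta>_pos m_bounds g G])
        (use Gm Hm He w in \<open>auto simp: less_imp_le\<close>)
  qed (fact P M iid n G ne meas env' dist a b C D B_sum)+
qed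

section \<open>The entropy bound\<close>

lemma epowr_1: "epowr x 1 = x"
  by (cases x) (auto simp: epowr_def)

theorem theorem3p5:
  fixes P :: "'a measure" and M :: "'o measure"
    and n :: nat and X :: "nat \<Rightarrow> 'o \<Rightarrow> 'a"
    and m \<kappa> \<sigma> :: real
    and \<F> :: "('a \<Rightarrow> real) set" and w F :: "'a \<Rightarrow> real"
  assumes "prob_space P" and "prob_space M"
    and "n \<ge> 1" and "iid_sample M P n X"
    and "m > 1" and "min m 2 = 1 + \<kappa>"
    and "\<And>f. f \<in> \<F> \<Longrightarrow> f \<in> borel_measurable P"
    and "\<sigma> > 0" and "(SUP f\<in>\<F>. Lp_norm P (1 + \<kappa>) f) \<le> ennreal \<sigma>"
    and "\<And>x. x \<in> space P \<Longrightarrow> w x > 0" and "in_Lp P m (\<lambda>x. 1 / w x)"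
    and "is_envelope (space P) \<F> F" and "weighted_sup_norm (space P) w F < \<infinity>"
  shows "outer_expectation M (\<lambda>\<omega>. sup_deviation (empirical_measure P n (\<lambda>i. X i \<omega>)) P \<F>)
    \<le> ennreal (127.63 / \<kappa>)
        * (epowr (Lp_norm P (1 + \<kappa>) (\<lambda>x. 1 / w x)) ((1 - \<kappa>) / 2)
            / ennreal (real n powr (\<kappa> / (1 + \<kappa>))))
        * epowr (entropy_integral \<F> (norm_dist (Lp_norm P (1 + \<kappa>)))
                  (\<kappa> / (1 + \<kappa>)) (ennreal (2 * \<sigma>)))
                ((1 + \<kappa>) / 2)
        * epowr (entropy_integral \<F> (norm_dist (weighted_sup_norm (space P) w))
                  (\<kappa> / (1 + \<kappa>)) (2 * weighted_sup_norm (space P) w F))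
                ((1 - \<kappa>) / 2)
      + ennreal (104.37 / \<kappa>)
        * (Lp_norm P m (\<lambda>x. 1 / w x) / ennreal (real n powr (1 - 1 / m)))
        * entropy_integral \<F> (norm_dist (weighted_sup_norm (space P) w))
            (1 - 1 / m) (2 * weighted_sup_norm (space P) w F)"
    (is "?E \<le> ?first + ?second")
proof -
  note P = assms(1) and M = assms(2) and n = assms(3) and iid = assms(4) and m = assms(5) and min = assms(6)
    and meas = assms(7) and \<sigma> = assms(8,9) and w = assms(10) and Lm = assms(11) and F = assms(12,13)
  interpret P: prob_space P by fact
  note X = iid_sampleD[OF M iid]
  have \<kappa>: "0 < \<kappa>" "\<kappa> \<le> 1" using m min by linarith+
  define b0 where "b0 = enn2real (weighted_sup_norm (space P) w F)"
  have b0_eq: "weighted_sup_norm (space P) w F = ennreal b0" using F(2) by (simp add: b0_def)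
  have b0_nn: "0 \<le> b0" by (simp add: b0_def)
  have env: "weighted_sup_norm (space P) w f \<le> ennreal b0" if f: "f \<in> \<F>" for f
    unfolding b0_eq[symmetric] weighted_sup_norm_def
  proof (intro SUP_subset_mono order_refl ennreal_leI)
    show "\<bar>f x\<bar> * w x \<le> \<bar>F x\<bar> * w x" if "x \<in> space P" for x
      using F(1) f that w[OF that] unfolding is_envelope_def
      by (intro mult_right_mono) (auto intro: order_trans)
  qed
  show ?thesis
  proof (cases "\<F> = {} \<or> b0 = 0")
    \<comment> \<open>No link or no positive initial radius: all deviations vanish.\<close>
    case True
    have zero: "f x = 0" if "f \<in> \<F>" "x \<in> space P" for f x
    proof -
      have "b0 = 0" using True that by auto
      then have "\<bar>f x\<bar> * w x \<le> 0" using env[OF that(1)] that(2) by (simp add: weighted_sup_norm_le_iff[of 0, simplified])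
      then show ?thesis using w[OF that(2)] by (simp add: mult_le_0_iff)
    qed
    have "sup_deviation (empirical_measure P n (\<lambda>i. X i \<omega>)) P \<F> \<le> 0" if \<omega>: "\<omega> \<in> space M" for \<omega>
    proof -
      have Xs: "X i \<omega> \<in> space P" if "i < n" for i
        using X(2)[OF that] \<omega> by (rule measurable_space)
      have "deviation P n (\<lambda>i. X i \<omega>) f = 0" if f: "f \<in> \<F>" for f
      proof -
        have "(\<integral>x. f x \<partial>P) = (\<integral>x. 0 \<partial>P)" using zero[OF f] by (intro Bochner_Integration.integral_cong) auto
        then show ?thesis using zero[OF f Xs] by (simp add: deviation_def)
      qed
      moreover have "sup_deviation (empirical_measure P n (\<lambda>i. X i \<omega>)) P \<F>
        = (SUP f\<in>\<F>. ennreal (deviation P n (\<lambda>i. X i \<omega>) f))"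
        using Xs meas by (rule sup_deviation_empirical)
      ultimately show ?thesis by (simp only:) (intro SUP_least, simp)
    qed
    then have "?E \<le> (\<integral>\<^sup>+\<omega>. 0 \<partial>M)"
      unfolding outer_expectation_def by (intro INF_lower) auto
    then show ?thesis by simp
  next
    case False
    then have ne: "\<F> \<noteq> {}" and b0: "0 < b0" using b0_nn by auto
    define G where "G x = 1 / w x" for x
    have G_pos: "0 < G x" if "x \<in> space P" for x using w[OF that] by (simp add: G_def)
    have G_meas [measurable]: "G \<in> borel_measurable P" using Lm by (simp add: in_Lp_def G_def[abs_def])
    define g where "g = enn2real (Lp_norm P m G)"
    have g_eq: "Lp_norm P m G = ennreal g" using Lm by (simp add: in_Lp_def g_def G_def[abs_def])
    have g_nn: "0 \<le> g" by (simp add: g_def)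
    have nn_Gm: "(\<integral>\<^sup>+x. ennreal (G x powr m) \<partial>P) \<le> ennreal (g powr m)"
    proof -
      have "(\<integral>\<^sup>+x. ennreal (\<bar>G x\<bar> powr m) \<partial>P) \<le> ennreal (g powr m)"
        using g_eq g_nn m by (subst Lp_norm_le_iff[symmetric]) auto
      also have "(\<integral>\<^sup>+x. ennreal (\<bar>G x\<bar> powr m) \<partial>P) = (\<integral>\<^sup>+x. ennreal (G x powr m) \<partial>P)"
        using G_pos by (intro nn_integral_cong) (simp add: less_imp_le)
      finally show ?thesis .
    qed
    have g: "0 < g"
    proof (rule ccontr)
      assume "\<not> 0 < g"
      then have "(\<integral>\<^sup>+x. ennreal (G x powr m) \<partial>P) = 0" using nn_Gm g_nn m by simp
      then have "AE x in P. ennreal (G x powr m) = 0" by (subst (asm) nn_integral_0_iff_AE) auto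
      moreover have "AE x in P. ennreal (G x powr m) \<noteq> 0" using G_pos by (intro AE_I2) force
      ultimately have "AE x in P. False" by eventually_elim simp
      then show False by simp
    qed
    have Gm: "integrable P (\<lambda>x. G x powr m)" "(\<integral>x. G x powr m \<partial>P) \<le> g powr m"
    proof -
      show "integrable P (\<lambda>x. G x powr m)"
        using nn_Gm by (intro integrableI_bounded) (auto simp: le_less_trans)
      show "(\<integral>x. G x powr m \<partial>P) \<le> g powr m"
        using nn_Gm by (intro integral_real_bounded) auto
    qed
    have G: "integrable P G"
    proof (rule Bochner_Integration.integrable_bound)
      show "integrable P (\<lambda>x. 1 + G x powr m)" using Gm by simp
      show "AE x in P. norm (G x) \<le> norm (1 + G x powr m)"
      proof (rule AE_I2)
        fix x assume x: "x \<in> space P"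
        have "G x \<le> 1 + G x powr m"
        proof (cases "G x \<le> 1")
          case False
          then have "G x powr 1 \<le> G x powr m" using m by (intro powr_mono) auto
          then show ?thesis using False by simp
        qed (simp add: add_increasing2)
        then show "norm (G x) \<le> norm (1 + G x powr m)" using G_pos[OF x] by simp
      qed
    qed simp
    let ?Jw = "entropy_integral \<F> (norm_dist (weighted_sup_norm (space P) w)) (1 - 1 / m) (ennreal (2 * b0))"
    have b0_2: "2 * weighted_sup_norm (space P) w F = ennreal (2 * b0)"
      using b0 by (simp add: b0_eq ennreal_mult)
    have second: "?second = ennreal (104.37 / \<kappa> * (g / real n powr (1 - 1 / m))) * ?Jw"
      unfolding b0_2 G_def[abs_def, symmetric] g_eq using g n \<kappa>
      by (simp add: divide_ennreal ennreal_mult[symmetric])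
    show ?thesis
    proof (cases "?Jw = \<infinity>")
      case True
      have "0 < 104.37 / \<kappa> * (g / real n powr (1 - 1 / m))" using \<kappa> g n by simp
      then have "?second = \<infinity>" unfolding second True
        using \<kappa> g n by (simp add: ennreal_mult_top)
      then show ?thesis by simp
    next
      case Jw_fin: False
      define Jw where "Jw = enn2real ?Jw"
      have Jw: "0 \<le> Jw" "?Jw = ennreal Jw"
        using Jw_fin by (simp_all add: Jw_def less_top)
      have second': "?second = ennreal (104.37 / \<kappa> * (g / real n powr (1 - 1 / m)) * Jw)"
        unfolding second Jw(2) using \<kappa> g Jw(1) by (subst ennreal_mult) auto
      show ?thesis
      proof (cases "m < 2")
        case True
        then have m_eq: "m = 1 + \<kappa>" using min by simp
        have "?E \<le> ennreal (104.37 / \<kappa> * (g / real n powr (1 - 1 / m)) * Jw)"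
          by (rule outer_expectation_sup_deviation_heavy_tailed[OF P M iid n ne \<kappa> m_eq b0 g meas w env])
            (use G Gm Jw in \<open>auto simp: G_def[abs_def]\<close>)
        also have "\<dots> \<le> ?first + ?second" unfolding second'[symmetric] by simp
        finally show ?thesis .
      next
        case m2: False
        then have \<kappa>1: "\<kappa> = 1" using min by simp
        let ?J2 = "entropy_integral \<F> (norm_dist (Lp_norm P 2)) (1 / 2) (ennreal (2 * \<sigma>))"
        have first: "?first = ennreal (127.63 / real n powr (1 / 2)) * ?J2"
        proof -
          have "?first = ennreal 127.63 * (1 / ennreal (real n powr (1 / 2))) * ?J2"
            by (simp add: \<kappa>1 epowr_1 epowr_def[of _ 0])
          also have "1 / ennreal (real n powr (1 / 2)) = ennreal (1 / real n powr (1 / 2))"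
            using n by (subst ennreal_1[symmetric], subst divide_ennreal) auto
          finally show ?thesis by (simp add: ennreal_mult[symmetric])
        qed
        show ?thesis
        proof (cases "?J2 = \<infinity>")
          case True
          have "0 < 127.63 / real n powr (1 / 2)" using n by simp
          then have "?first = \<infinity>" unfolding first True
            using n by (simp add: ennreal_mult_top)
          then show ?thesis by simp
        next
          case J2_fin: False
          define J2 where "J2 = enn2real ?J2"
          have J2: "0 \<le> J2" "?J2 = ennreal J2"
            using J2_fin by (simp_all add: J2_def less_top)
          have L2: "Lp_norm P 2 f \<le> ennreal \<sigma>" if "f \<in> \<F>" for f
            using \<sigma>(2) that by (simp add: \<kappa>1 SUP_le_iff)
          have "?E \<le> ennreal (127.63 / real n powr (1 / 2) * J2 + 104.37 * (g / real n powr (1 - 1 / m)) * Jw)"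
            by (rule outer_expectation_sup_deviation_square_integrable[OF P M iid n ne _ \<sigma>(1) b0 g meas L2 w env])
              (use m2 G Gm J2 Jw in \<open>auto simp: G_def[abs_def]\<close>)
          also have "\<dots> = ennreal (127.63 / real n powr (1 / 2) * J2)
              + ennreal (104.37 * (g / real n powr (1 - 1 / m)) * Jw)"
            using J2(1) Jw(1) g by (intro ennreal_plus) auto
          also have "ennreal (127.63 / real n powr (1 / 2) * J2) = ?first"
            unfolding first J2(2) using J2(1) by (rule ennreal_mult'')
          also have "ennreal (104.37 * (g / real n powr (1 - 1 / m)) * Jw) = ?second"
            unfolding second' by (simp add: \<kappa>1)
          finally show ?thesis .
        qed
      qed
    qed
  qed
qed

end
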